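(* Let $S(t)=\sum_{i=1}^{N(t)}\sigma_i$ be a compound renewal process and let $0<a<1$. Assume there exist $\gamma_i>0$ ($i=1,2$) and an $\epsilon>0$ such that $E[e^{-\gamma_ip_i\zeta}]\,E[e^{\gamma_i\sigma}]=1$ and $E[e^{(\gamma_i+\epsilon)\sigma}]<\infty$ for $i=1,2$. Then, as $K\to\infty$, $$\psi_{\mathrm{or}}(aK,K)\sim C_2e^{-\gamma_2K}+C_1e^{-\gamma_1aK},$$ $$\psi_{\mathrm{and}}(aK,K)=o\big(C_2e^{-\gamma_2K}+C_1e^{-\gamma_1aK}\big).$$
   Context: $N(t)$ is a renewal process with i.i.d. interarrival times $\zeta_i$ (generic copy $\zeta$), and the claims $\sigma_i$ (generic copy $\sigma$) are i.i.d. nonnegative random variables independent of $N$. For $i=1,2$, $X_i(t)=x_i+p_it-S(t)$ with premium rates $p_1>p_2$ satisfying $p_i>E\sigma/E\zeta$. Write $\tau_i(x_i)=\inf\{t\ge0:X_i(t)<0\}$, $\psi_i(x_i)=P(\tau_i(x_i)<\infty)$, $\psi_{\mathrm{or}}(x_1,x_2)=P(\exists\,t\ge0:X_1(t)<0\text{ or }X_2(t)<0)$, $\psi_{\mathrm{and}}(x_1,x_2)=P(\tau_1(x_1)<\infty\text{ and }\tau_2(x_2)<\infty)$. The constant $C_i>0$ is the Cramér–Lundberg asymptotic constant of $X_i$: $C_i=\lim_{x\to\infty}e^{\gamma_ix}\psi_i(x)$. Here $f\sim h$ means $f/h\to1$ and $f=o(h)$ means $f/h\to0$. *)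

theory Defs
  imports "HOL-Probability.Probability" "HOL-Library.Landau_Symbols"
begin

text \<open>
  The sequences \<open>\<zeta>\<close> (interarrival times) and \<open>\<sigma>\<close> (claims) are indexed from 0: the \<open>n\<close>-th arrival
  epoch is \<open>\<zeta> 0 + \<dots> + \<zeta> (n - 1)\<close>, and the claim arriving at epoch \<open>Suc n\<close> is \<open>\<sigma> n\<close>.
\<close>

definition arrival_time :: "(nat \<Rightarrow> 'a \<Rightarrow> real) \<Rightarrow> nat \<Rightarrow> 'a \<Rightarrow> real" where
  "arrival_time \<zeta> n \<omega> = (\<Sum>i<n. \<zeta> i \<omega>)"

text \<open>
  If interarrival times are i.i.d., nonnegative and not almost surely 0, the set below is finite
  for all \<open>t\<close> outside a null event; on that null event \<open>card\<close> yields the irrelevant value 0.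
\<close>

definition renewal_process :: "(nat \<Rightarrow> 'a \<Rightarrow> real) \<Rightarrow> real \<Rightarrow> 'a \<Rightarrow> nat" where
  "renewal_process \<zeta> t \<omega> = card {n. 1 \<le> n \<and> arrival_time \<zeta> n \<omega> \<le> t}"

definition compound_renewal ::
    "(nat \<Rightarrow> 'a \<Rightarrow> real) \<Rightarrow> (nat \<Rightarrow> 'a \<Rightarrow> real) \<Rightarrow> real \<Rightarrow> 'a \<Rightarrow> real" where
  "compound_renewal \<zeta> \<sigma> t \<omega> = (\<Sum>i<renewal_process \<zeta> t \<omega>. \<sigma> i \<omega>)"

definition risk_process ::
    "(nat \<Rightarrow> 'a \<Rightarrow> real) \<Rightarrow> (nat \<Rightarrow> 'a \<Rightarrow> real) \<Rightarrow> real \<Rightarrow> real \<Rightarrow> real \<Rightarrow> 'a \<Rightarrow> real" where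
  "risk_process \<zeta> \<sigma> p x t \<omega> = x + p * t - compound_renewal \<zeta> \<sigma> t \<omega>"

definition ruin_time ::
    "(nat \<Rightarrow> 'a \<Rightarrow> real) \<Rightarrow> (nat \<Rightarrow> 'a \<Rightarrow> real) \<Rightarrow> real \<Rightarrow> real \<Rightarrow> 'a \<Rightarrow> ereal" where
  "ruin_time \<zeta> \<sigma> p x \<omega> = Inf (ereal ` {t. 0 \<le> t \<and> risk_process \<zeta> \<sigma> p x t \<omega> < 0})"

definition ruin_prob ::
    "'a measure \<Rightarrow> (nat \<Rightarrow> 'a \<Rightarrow> real) \<Rightarrow> (nat \<Rightarrow> 'a \<Rightarrow> real) \<Rightarrow> real \<Rightarrow> real \<Rightarrow> real" where
  "ruin_prob M \<zeta> \<sigma> p x = measure M {\<omega> \<in> space M. ruin_time \<zeta> \<sigma> p x \<omega> < \<infinity>}"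

definition ruin_prob_or ::
    "'a measure \<Rightarrow> (nat \<Rightarrow> 'a \<Rightarrow> real) \<Rightarrow> (nat \<Rightarrow> 'a \<Rightarrow> real) \<Rightarrow>
      real \<Rightarrow> real \<Rightarrow> real \<Rightarrow> real \<Rightarrow> real" where
  "ruin_prob_or M \<zeta> \<sigma> p1 p2 x1 x2 =
    measure M {\<omega> \<in> space M. \<exists>t\<ge>0. risk_process \<zeta> \<sigma> p1 x1 t \<omega> < 0 \<or>
                                     risk_process \<zeta> \<sigma> p2 x2 t \<omega> < 0}"

definition ruin_prob_and ::
    "'a measure \<Rightarrow> (nat \<Rightarrow> 'a \<Rightarrow> real) \<Rightarrow> (nat \<Rightarrow> 'a \<Rightarrow> real) \<Rightarrow>
      real \<Rightarrow> real \<Rightarrow> real \<Rightarrow> real \<Rightarrow> real" where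
  "ruin_prob_and M \<zeta> \<sigma> p1 p2 x1 x2 =
    measure M {\<omega> \<in> space M. ruin_time \<zeta> \<sigma> p1 x1 \<omega> < \<infinity> \<and> ruin_time \<zeta> \<sigma> p2 x2 \<omega> < \<infinity>}"

text \<open>Independence and equality in law; the generic copy of the sequence is \<open>X 0\<close>.\<close>

definition iid :: "'a measure \<Rightarrow> (nat \<Rightarrow> 'a \<Rightarrow> real) \<Rightarrow> bool" where
  "iid M X \<longleftrightarrow> prob_space.indep_vars M (\<lambda>_. borel) X UNIV \<and>
             (\<forall>n. distr M borel (X n) = distr M borel (X 0))"

text \<open>
  Independence of the claims and the renewal process is stated as independence of the whole
  sequences of claims and interarrival times.  Ratios of means are taken in \<open>ennreal\<close>, so the mean
  interarrival time may be infinite, in which case the ratio is 0.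
\<close>

locale two_dim_compound_renewal_risk = prob_space M
  for M :: "'a measure" +
  fixes \<zeta> \<sigma> :: "nat \<Rightarrow> 'a \<Rightarrow> real" and p1 p2 :: real
  assumes interarrival_iid: "iid M \<zeta>"
    and interarrival_nonneg: "\<And>n \<omega>. \<omega> \<in> space M \<Longrightarrow> 0 \<le> \<zeta> n \<omega>"
    and interarrival_nontrivial: "0 < prob {\<omega> \<in> space M. 0 < \<zeta> 0 \<omega>}"
    and claims_iid: "iid M \<sigma>"
    and claims_nonneg: "\<And>n \<omega>. \<omega> \<in> space M \<Longrightarrow> 0 \<le> \<sigma> n \<omega>"
    and claims_indep_interarrivals:
      "indep_var (\<Pi>\<^sub>M i\<in>UNIV. borel) (\<lambda>\<omega>. \<lambda>i\<in>UNIV. \<zeta> i \<omega>)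
                 (\<Pi>\<^sub>M i\<in>UNIV. borel) (\<lambda>\<omega>. \<lambda>i\<in>UNIV. \<sigma> i \<omega>)"
    and premium_order: "p2 < p1"
    and net_profit1: "(\<integral>\<^sup>+\<omega>. ennreal (\<sigma> 0 \<omega>) \<partial>M) / (\<integral>\<^sup>+\<omega>. ennreal (\<zeta> 0 \<omega>) \<partial>M) < ennreal p1"
    and net_profit2: "(\<integral>\<^sup>+\<omega>. ennreal (\<sigma> 0 \<omega>) \<partial>M) / (\<integral>\<^sup>+\<omega>. ennreal (\<zeta> 0 \<omega>) \<partial>M) < ennreal p2"

end

theory Submission
  imports Defs
begin

text \<open>
  Write \<open>T n\<close> for the \<open>n\<close>-th arrival epoch and \<open>S n\<close> for the sum of the first \<open>n\<close> claims. A surplus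
  process only decreases at arrivals, so the process with premium rate \<open>p\<close> and initial capital \<open>x\<close> is
  almost surely ruined exactly when the point \<open>(T n, S n)\<close> lies above the line \<open>x + p t\<close> for some \<open>n\<close>. Since
  the event that one of the processes is ruined has probability \<open>\<psi>1 + \<psi>2 - \<psi>and\<close>, and the asymptotics
  of \<open>\<psi>1\<close> and \<open>\<psi>2\<close> are given, it is enough to prove that \<open>\<psi>and\<close> is negligible.

  The lines \<open>a K + p1 t\<close> and \<open>K + p2 t\<close> cross at time \<open>t K\<close> with \<open>t = (1 - a) / (p1 - p2)\<close>. Consider
  linear functionals \<open>\<theta> S - s T\<close> whose exponential has mean \<open>mgf \<theta> s\<close> over one step. At the crossing
  point the functionals \<open>(\<gamma>1, \<gamma>1 p1)\<close> and \<open>(\<gamma>2, \<gamma>2 p2)\<close>, for which this mean is 1, take the values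
  \<open>\<gamma>1 a K\<close> and \<open>\<gamma>2 K\<close>; these are the two decay exponents. Their midpoint has mean strictly less
  than 1 (\<open>mgf_midpoint_less_1\<close>), so \<open>s\<close> can be lowered a little, which raises the value at the crossing point
  strictly above the average of the exponents. Hence the event that \<open>\<theta> S - s T\<close> ever exceeds a
  suitable \<open>c K\<close> below that value is negligible against \<open>exp (- \<gamma>1 a K) + exp (- \<gamma>2 K)\<close>
  by a union bound over \<open>n\<close>.

  Off this event, paths stay below a third line, which passes below the crossing point with a slope
  between \<open>p2\<close> and \<open>p1\<close>. A path that exceeds both barriers must then exceed the first one
  before the crossing time and the second one after it, and when it exceeds the first barrier it is
  still a distance proportional to \<open>K\<close> below the second
  (\<open>gap_when_both_lines_are_exceeded\<close>). Stopping at the first exceedance of the first barrier, the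
  remaining climb is independent of the past, and by the net profit condition it has exponentially
  small probability (\<open>mgf_half_less_1\<close>), so this part
  costs \<open>\<psi>1(a K)\<close> times a factor that tends to 0 (\<open>joint_ruin_bound\<close>).
\<close>

section \<open>Paths and ruin at arrival epochs\<close>

context two_dim_compound_renewal_risk
begin

abbreviation T :: "nat \<Rightarrow> 'a \<Rightarrow> real" where
  "T \<equiv> arrival_time \<zeta>"

definition S :: "nat \<Rightarrow> 'a \<Rightarrow> real" where
  "S n \<omega> = (\<Sum>i<n. \<sigma> i \<omega>)"

lemma interarrival_measurable [measurable]: "\<zeta> i \<in> borel_measurable M"
  and claim_measurable [measurable]: "\<sigma> i \<in> borel_measurable M"
  using interarrival_iid claims_iid by (auto simp: iid_def indep_vars_def)

lemma T_measurable [measurable]: "T n \<in> borel_measurable M"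
  unfolding arrival_time_def by measurable

lemma S_measurable [measurable]: "S n \<in> borel_measurable M"
  unfolding S_def by measurable

lemma T_mono: "\<omega> \<in> space M \<Longrightarrow> m \<le> n \<Longrightarrow> T m \<omega> \<le> T n \<omega>"
  unfolding arrival_time_def by (intro sum_mono2) (auto simp: interarrival_nonneg)

lemma S_mono: "\<omega> \<in> space M \<Longrightarrow> m \<le> n \<Longrightarrow> S m \<omega> \<le> S n \<omega>"
  unfolding S_def by (intro sum_mono2) (auto simp: claims_nonneg)

lemma T_nonneg: "\<omega> \<in> space M \<Longrightarrow> 0 \<le> T n \<omega>"
  unfolding arrival_time_def by (intro sum_nonneg) (auto simp: interarrival_nonneg)

lemma T_0 [simp]: "T 0 \<omega> = 0" and S_0 [simp]: "S 0 \<omega> = 0"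
  by (simp_all add: arrival_time_def S_def)

lemma premium_pos: "0 < p1" "0 < p2"
proof -
  show "0 < p2"
    using net_profit2 ennreal_neg[of p2] by (cases "p2 > 0") auto
  with premium_order show "0 < p1" by simp
qed

text \<open>
  The hypothesis \<open>t < T m \<omega>\<close> rules out infinitely many arrivals up to \<open>t\<close>; there the cardinality that
  counts arrivals would be 0.
\<close>

lemma arrival_le_iff_le_count:
  assumes w: "\<omega> \<in> space M" and "0 \<le> t" "t < T m \<omega>"
  shows "T k \<omega> \<le> t \<longleftrightarrow> k \<le> renewal_process \<zeta> t \<omega>"
proof -
  let ?P = "{k. T k \<omega> \<le> t}"
  have "k < m" if "T k \<omega> \<le> t" for k
    using that T_mono[OF w, of m k] assms(3) by (meson le_less_trans not_le)
  then have fin: "finite ?P" by (intro finite_subset[of ?P "{..<m}"]) auto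
  have zero: "0 \<in> ?P" using assms(2) by simp
  define c where "c = Max ?P"
  have c: "T c \<omega> \<le> t" using Max_in[OF fin] zero unfolding c_def by blast
  have P: "T k \<omega> \<le> t \<longleftrightarrow> k \<le> c" for k
    using Max_ge[OF fin, of k] T_mono[OF w, of k c] c by (auto simp: c_def)
  have "{k. 1 \<le> k \<and> T k \<omega> \<le> t} = {1..c}" by (auto simp: P)
  then have "renewal_process \<zeta> t \<omega> = c" by (simp add: renewal_process_def)
  then show ?thesis by (simp add: P)
qed

text \<open>
  Between arrivals the surplus grows, so ruin can be read off at arrival epochs. The condition that
  some arrival comes strictly later is what makes the equivalence hold on every path: if no arrival
  comes after \<open>T n \<omega>\<close>, the claim count at that time is the default 0. An exact equivalence yields the
  measurability of the ruin events, which an almost sure one would not. If several arrivals coincide,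
  the claim count at \<open>T n \<omega>\<close> may exceed \<open>n\<close>, which only increases the loss.
\<close>

lemma ruin_iff:
  assumes w: "\<omega> \<in> space M" and p: "0 < p" and x: "0 \<le> x"
  shows "(\<exists>t\<ge>0. risk_process \<zeta> \<sigma> p x t \<omega> < 0) \<longleftrightarrow>
         (\<exists>n. x + p * T n \<omega> < S n \<omega> \<and> (\<exists>m. T n \<omega> < T m \<omega>))"
proof -
  have risk: "risk_process \<zeta> \<sigma> p x t \<omega> = x + p * t - S (renewal_process \<zeta> t \<omega>) \<omega>" for t
    by (simp add: risk_process_def compound_renewal_def S_def)
  show ?thesis
  proof
    assume "\<exists>t\<ge>0. risk_process \<zeta> \<sigma> p x t \<omega> < 0"
    then obtain t where t: "0 \<le> t" "x + p * t < S (renewal_process \<zeta> t \<omega>) \<omega>"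
      by (auto simp: risk)
    have "\<exists>m. t < T m \<omega>"
    proof (rule ccontr)
      assume "\<not> (\<exists>m. t < T m \<omega>)"
      then have "{k. 1 \<le> k \<and> T k \<omega> \<le> t} = {1..}" by (auto simp: not_less)
      then have "renewal_process \<zeta> t \<omega> = 0" by (simp add: renewal_process_def infinite_Ici)
      then show False using t x p mult_nonneg_nonneg[of p t] unfolding not_less[symmetric] by auto
    qed
    then obtain m where m: "t < T m \<omega>" by blast
    let ?n = "renewal_process \<zeta> t \<omega>"
    have le: "T ?n \<omega> \<le> t" using arrival_le_iff_le_count[OF w t(1) m] by simp
    then have "x + p * T ?n \<omega> < S ?n \<omega>"
      using t(2) mult_left_mono[OF le, of p] p by linarith
    with le m show "\<exists>n. x + p * T n \<omega> < S n \<omega> \<and> (\<exists>m. T n \<omega> < T m \<omega>)"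
      by (meson le_less_trans)
  next
    assume "\<exists>n. x + p * T n \<omega> < S n \<omega> \<and> (\<exists>m. T n \<omega> < T m \<omega>)"
    then obtain n m where n: "x + p * T n \<omega> < S n \<omega>" and m: "T n \<omega> < T m \<omega>" by blast
    have "n \<le> renewal_process \<zeta> (T n \<omega>) \<omega>"
      using arrival_le_iff_le_count[OF w T_nonneg[OF w] m, of n] by simp
    then have "S n \<omega> \<le> S (renewal_process \<zeta> (T n \<omega>) \<omega>) \<omega>" by (rule S_mono[OF w])
    then show "\<exists>t\<ge>0. risk_process \<zeta> \<sigma> p x t \<omega> < 0"
      using n T_nonneg[OF w, of n] by (intro exI[of _ "T n \<omega>"]) (simp add: risk)
  qed
qed

section \<open>Joint independence of interarrival times and claims\<close>

text \<open>
  All interarrival times and claims as one family, so that past and future become two disjoint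
  index sets of a single independent family.
\<close>

definition inputs :: "nat + nat \<Rightarrow> 'a \<Rightarrow> real" where
  "inputs = case_sum \<zeta> \<sigma>"

lemma inputs_simps [simp]: "inputs (Inl i) = \<zeta> i" "inputs (Inr i) = \<sigma> i"
  by (simp_all add: inputs_def)

lemma inputs_measurable [measurable]: "inputs k \<in> borel_measurable M"
  by (cases k) simp_all

text \<open>
  A finite intersection of events about the family splits into one event about the interarrival
  sequence and one about the claim sequence; these are independent of each other, and each of them
  factorizes within its own sequence.
\<close>

lemma indep_inputs: "indep_vars (\<lambda>_. borel) inputs UNIV"
  unfolding indep_vars_def2
proof (intro conjI ballI indep_setsI)
  fix k show "random_variable borel (inputs k)" by measurable
next
  fix k show "{inputs k -` A \<inter> space M |A. A \<in> sets borel} \<subseteq> events"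
    by (auto intro!: measurable_sets[OF inputs_measurable])
next
  fix A :: "nat + nat \<Rightarrow> 'a set" and J :: "(nat + nat) set"
  assume J: "J \<noteq> {}" "finite J"
    and A: "\<forall>j\<in>J. A j \<in> {inputs j -` A \<inter> space M |A. A \<in> sets borel}"
  then have "\<forall>j\<in>J. \<exists>B. A j = inputs j -` B \<inter> space M \<and> B \<in> sets borel" by blast
  then obtain B where B: "\<And>j. j \<in> J \<Longrightarrow> A j = inputs j -` B j \<inter> space M"
    "\<And>j. j \<in> J \<Longrightarrow> B j \<in> sets borel"
    by metis
  define L R where "L = Inl -` J" and "R = Inr -` J"
  have fin: "finite L" "finite R"
    using J by (auto simp: L_def R_def intro!: finite_vimageI)
  have J_eq: "J = Inl ` L \<union> Inr ` R"
  proof (intro equalityI subsetI)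
    fix k assume "k \<in> J" then show "k \<in> Inl ` L \<union> Inr ` R"
      by (cases k) (auto simp: L_def R_def)
  qed (auto simp: L_def R_def)
  define CL where "CL = {x \<in> space (\<Pi>\<^sub>M i\<in>(UNIV::nat set). (borel::real measure)). \<forall>i\<in>L. x i \<in> B (Inl i)}"
  define CR where "CR = {x \<in> space (\<Pi>\<^sub>M i\<in>(UNIV::nat set). (borel::real measure)). \<forall>i\<in>R. x i \<in> B (Inr i)}"
  have [measurable]: "i \<in> L \<Longrightarrow> B (Inl i) \<in> sets borel" "i \<in> R \<Longrightarrow> B (Inr i) \<in> sets borel" for i
    using B(2) by (auto simp: L_def R_def)
  have CL: "CL \<in> sets (\<Pi>\<^sub>M i\<in>UNIV. borel)" and CR: "CR \<in> sets (\<Pi>\<^sub>M i\<in>UNIV. borel)"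
    unfolding CL_def CR_def using fin by measurable
  have "(\<Inter>j\<in>J. A j) = (\<lambda>\<omega>. (\<lambda>i\<in>UNIV. \<zeta> i \<omega>, \<lambda>i\<in>UNIV. \<sigma> i \<omega>)) -` (CL \<times> CR) \<inter> space M"
  proof -
    have "(\<Inter>j\<in>J. A j) = {\<omega> \<in> space M. \<forall>j\<in>J. inputs j \<omega> \<in> B j}"
      using J(1) by (auto simp: B(1))
    then show ?thesis
      by (auto simp: J_eq ball_Un CL_def CR_def space_PiM)
  qed
  then have "prob (\<Inter>j\<in>J. A j) = prob ((\<lambda>\<omega>. \<lambda>i\<in>UNIV. \<zeta> i \<omega>) -` CL \<inter> space M) *
      prob ((\<lambda>\<omega>. \<lambda>i\<in>UNIV. \<sigma> i \<omega>) -` CR \<inter> space M)"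
    using indep_varD[OF claims_indep_interarrivals CL CR] by simp
  also have "prob ((\<lambda>\<omega>. \<lambda>i\<in>UNIV. \<zeta> i \<omega>) -` CL \<inter> space M) = (\<Prod>i\<in>L. prob (A (Inl i)))"
  proof (cases "L = {}")
    case True
    have "(\<lambda>\<omega>. \<lambda>i\<in>UNIV. \<zeta> i \<omega>) -` CL \<inter> space M = space M"
      using True by (auto simp: CL_def space_PiM)
    then show ?thesis using True prob_space by simp
  next
    case False
    have "(\<lambda>\<omega>. \<lambda>i\<in>UNIV. \<zeta> i \<omega>) -` CL \<inter> space M = (\<Inter>i\<in>L. \<zeta> i -` B (Inl i) \<inter> space M)"
      using False by (auto simp: CL_def space_PiM)
    also have "prob \<dots> = (\<Prod>i\<in>L. prob (\<zeta> i -` B (Inl i) \<inter> space M))"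
      using interarrival_iid False fin by (intro indep_varsD[where I=UNIV]) (auto simp: iid_def)
    finally show ?thesis by (simp add: B(1) J_eq)
  qed
  also have "prob ((\<lambda>\<omega>. \<lambda>i\<in>UNIV. \<sigma> i \<omega>) -` CR \<inter> space M) = (\<Prod>i\<in>R. prob (A (Inr i)))"
  proof (cases "R = {}")
    case True
    have "(\<lambda>\<omega>. \<lambda>i\<in>UNIV. \<sigma> i \<omega>) -` CR \<inter> space M = space M"
      using True by (auto simp: CR_def space_PiM)
    then show ?thesis using True prob_space by simp
  next
    case False
    have "(\<lambda>\<omega>. \<lambda>i\<in>UNIV. \<sigma> i \<omega>) -` CR \<inter> space M = (\<Inter>i\<in>R. \<sigma> i -` B (Inr i) \<inter> space M)"
      using False by (auto simp: CR_def space_PiM)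
    also have "prob \<dots> = (\<Prod>i\<in>R. prob (\<sigma> i -` B (Inr i) \<inter> space M))"
      using claims_iid False fin by (intro indep_varsD[where I=UNIV]) (auto simp: iid_def)
    finally show ?thesis by (simp add: B(1) J_eq)
  qed
  also have "(\<Prod>i\<in>L. prob (A (Inl i))) * (\<Prod>i\<in>R. prob (A (Inr i))) = (\<Prod>j\<in>J. prob (A j))"
    unfolding J_eq using fin
    by (subst prod.union_disjoint) (auto simp: prod.reindex)
  finally show "prob (\<Inter>j\<in>J. A j) = (\<Prod>j\<in>J. prob (A j))" .
qed

definition block :: "nat \<Rightarrow> nat \<Rightarrow> (nat + nat) set" where
  "block m n = Inl ` {m..<n} \<union> Inr ` {m..<n}"

abbreviation history :: "nat \<Rightarrow> 'a \<Rightarrow> nat + nat \<Rightarrow> real" where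
  "history n \<omega> \<equiv> restrict (\<lambda>k. inputs k \<omega>) (block 0 n)"

section \<open>Exponential bounds for increments\<close>

text \<open>
  For \<open>s \<ge> 0\<close> and integrable \<open>exp (\<theta> \<sigma>)\<close> this is the mean of \<open>exp (\<theta> \<sigma> - s \<zeta>)\<close>, so the Cramer
  conditions say that it equals 1 at \<open>(\<gamma>, \<gamma> p)\<close>.
\<close>

definition mgf :: "real \<Rightarrow> real \<Rightarrow> real" where
  "mgf \<theta> s = (\<integral>\<omega>. exp (\<theta> * \<sigma> 0 \<omega>) \<partial>M) * (\<integral>\<omega>. exp (- (s * \<zeta> 0 \<omega>)) \<partial>M)"

lemma history_measurable [measurable]:
  "history n \<in> measurable M (\<Pi>\<^sub>M k\<in>block 0 n. borel)"
  by (intro measurable_restrict inputs_measurable)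

lemma same_law:
  fixes f :: "real \<Rightarrow> real"
  assumes [measurable]: "f \<in> borel_measurable borel" and X: "iid M X"
    and [measurable]: "\<And>i. X i \<in> borel_measurable M"
  shows "(\<integral>\<omega>. f (X i \<omega>) \<partial>M) = (\<integral>\<omega>. f (X 0 \<omega>) \<partial>M)"
    and "integrable M (\<lambda>\<omega>. f (X i \<omega>)) \<longleftrightarrow> integrable M (\<lambda>\<omega>. f (X 0 \<omega>))"
proof -
  have eq: "distr M borel (X i) = distr M borel (X 0)"
    using X by (auto simp: iid_def)
  have "(\<integral>\<omega>. f (X j \<omega>) \<partial>M) = (\<integral>x. f x \<partial>distr M borel (X j))" for j
    by (simp add: integral_distr)
  then show "(\<integral>\<omega>. f (X i \<omega>) \<partial>M) = (\<integral>\<omega>. f (X 0 \<omega>) \<partial>M)"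
    by (simp add: eq)
  have "integrable M (\<lambda>\<omega>. f (X j \<omega>)) \<longleftrightarrow> integrable (distr M borel (X j)) f" for j
    by (simp add: integrable_distr_eq)
  then show "integrable M (\<lambda>\<omega>. f (X i \<omega>)) \<longleftrightarrow> integrable M (\<lambda>\<omega>. f (X 0 \<omega>))"
    by (simp add: eq)
qed

lemma integrable_exp_interarrival:
  assumes "0 \<le> s" shows "integrable M (\<lambda>\<omega>. exp (- (s * \<zeta> i \<omega>)))"
  using assms interarrival_nonneg
  by (intro integrable_const_bound[where B=1]) (auto intro!: AE_I2)

text \<open>
  The indicator depends on the block of inputs before \<open>n\<close> and the increment on the block from \<open>n\<close>
  to \<open>m\<close>; the exponential of the increment is itself a product of independent factors.
\<close>

lemma exp_increment:
  assumes G: "G \<in> sets (\<Pi>\<^sub>M k\<in>block 0 n. borel)" and mn: "n \<le> m" and s: "0 \<le> s"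
    and int: "integrable M (\<lambda>\<omega>. exp (\<theta> * \<sigma> 0 \<omega>))"
  shows "integrable M (\<lambda>\<omega>. indicator G (history n \<omega>) *
           exp (\<theta> * (S m \<omega> - S n \<omega>) - s * (T m \<omega> - T n \<omega>)))"
    and "(\<integral>\<omega>. indicator G (history n \<omega>) *
           exp (\<theta> * (S m \<omega> - S n \<omega>) - s * (T m \<omega> - T n \<omega>)) \<partial>M) =
         prob {\<omega>\<in>space M. history n \<omega> \<in> G} * mgf \<theta> s ^ (m - n)"
proof -
  define w :: "nat + nat \<Rightarrow> real" where "w = case_sum (\<lambda>_. - s) (\<lambda>_. \<theta>)"
  let ?B = "block n m"
  let ?X = "\<lambda>\<omega>. indicator G (history n \<omega>) :: real"
  let ?Y = "\<lambda>\<omega>. \<Prod>k\<in>?B. exp (w k * inputs k \<omega>)"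
  have fin: "finite ?B" by (simp add: block_def)
  have disj: "block 0 n \<inter> ?B = {}" by (auto simp: block_def)
  have "indep_var borel (indicator G \<circ> history n)
        borel ((\<lambda>x. \<Prod>k\<in>?B. exp (w k * x k)) \<circ> (\<lambda>\<omega>. restrict (\<lambda>k. inputs k \<omega>) ?B))"
    using G by (intro indep_var_compose[OF indep_var_restrict[OF indep_inputs disj]]) auto
  also have "(\<lambda>x. \<Prod>k\<in>?B. exp (w k * x k)) \<circ> (\<lambda>\<omega>. restrict (\<lambda>k. inputs k \<omega>) ?B) = ?Y"
    by (auto intro!: prod.cong)
  finally have indep: "indep_var borel ?X borel ?Y" unfolding comp_def .
  have split_prod: "(\<Prod>k\<in>?B. f k) = (\<Prod>i\<in>{n..<m}. f (Inl i)) * (\<Prod>i\<in>{n..<m}. f (Inr i))"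
    for f :: "nat + nat \<Rightarrow> real"
    unfolding block_def by (subst prod.union_disjoint) (auto simp: prod.reindex)
  have Y_eq: "?Y \<omega> = exp (\<theta> * (S m \<omega> - S n \<omega>) - s * (T m \<omega> - T n \<omega>))" for \<omega>
  proof -
    have diff: "(\<Sum>i<m. f i) - (\<Sum>i<n. f i) = (\<Sum>i\<in>{n..<m}. f i)" for f :: "nat \<Rightarrow> real"
      using sum_diff_nat_ivl[of 0 n m f] mn by (simp add: lessThan_atLeast0)
    have "?Y \<omega> = exp (\<Sum>i\<in>{n..<m}. - (s * \<zeta> i \<omega>)) * exp (\<Sum>i\<in>{n..<m}. \<theta> * \<sigma> i \<omega>)"
      by (simp add: split_prod w_def exp_sum)
    then show ?thesis
      by (simp add: S_def arrival_time_def diff sum_distrib_left[symmetric] sum_negf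
        exp_add[symmetric] del: exp_sum)
  qed
  have int1: "integrable M (\<lambda>\<omega>. exp (w k * inputs k \<omega>))" for k
  proof (cases k)
    case (Inl i)
    then show ?thesis using integrable_exp_interarrival[OF s, of i] by (simp add: w_def)
  next
    case (Inr i)
    then show ?thesis using same_law(2)[OF _ claims_iid, of "\<lambda>x. exp (\<theta> * x)" i] int by (simp add: w_def)
  qed
  have indepB: "indep_vars (\<lambda>_. borel) (\<lambda>k \<omega>. exp (w k * inputs k \<omega>)) ?B"
    using indep_vars_compose2[OF indep_vars_subset[OF indep_inputs subset_UNIV], of ?B "\<lambda>k x. exp (w k * x)" "\<lambda>_. borel"]
    by simp
  have intY: "integrable M ?Y"
    by (rule indep_vars_integrable[OF fin indepB int1])
  have "expectation ?Y = (\<Prod>k\<in>?B. \<integral>\<omega>. exp (w k * inputs k \<omega>) \<partial>M)"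
    by (rule indep_vars_lebesgue_integral[OF fin indepB int1])
  also have "\<dots> = mgf \<theta> s ^ (m - n)"
  proof -
    have "(\<integral>\<omega>. exp (\<theta> * \<sigma> i \<omega>) \<partial>M) = (\<integral>\<omega>. exp (\<theta> * \<sigma> 0 \<omega>) \<partial>M)"
      "(\<integral>\<omega>. exp (- (s * \<zeta> i \<omega>)) \<partial>M) = (\<integral>\<omega>. exp (- (s * \<zeta> 0 \<omega>)) \<partial>M)" for i
      using same_law(1)[OF _ claims_iid, of "\<lambda>x. exp (\<theta> * x)" i]
        same_law(1)[OF _ interarrival_iid, of "\<lambda>x. exp (- (s * x))" i] by simp_all
    then have "(\<Prod>i\<in>{n..<m}. \<integral>\<omega>. exp (\<theta> * \<sigma> i \<omega>) \<partial>M) = (\<integral>\<omega>. exp (\<theta> * \<sigma> 0 \<omega>) \<partial>M) ^ (m - n)"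
      "(\<Prod>i\<in>{n..<m}. \<integral>\<omega>. exp (- (s * \<zeta> i \<omega>)) \<partial>M) = (\<integral>\<omega>. exp (- (s * \<zeta> 0 \<omega>)) \<partial>M) ^ (m - n)"
      by (metis (no_types, lifting) prod.cong prod_constant card_atLeastLessThan)+
    then show ?thesis
      by (simp add: split_prod mgf_def w_def power_mult_distrib mult.commute)
  qed
  finally have EY: "expectation ?Y = mgf \<theta> s ^ (m - n)" .
  have HG: "{\<omega>\<in>space M. history n \<omega> \<in> G} \<in> events"
    using measurable_sets[OF history_measurable G] by (simp add: vimage_def Int_def conj_commute)
  have X_ind: "?X \<omega> = indicator {\<omega>\<in>space M. history n \<omega> \<in> G} \<omega>" if "\<omega> \<in> space M" for \<omega>
    using that by (auto simp: indicator_def)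
  have intX: "integrable M ?X"
    using HG by (subst Bochner_Integration.integrable_cong[OF refl X_ind]) (auto simp: less_top[symmetric])
  have EX: "expectation ?X = prob {\<omega>\<in>space M. history n \<omega> \<in> G}"
    using HG by (subst Bochner_Integration.integral_cong[OF refl X_ind]) auto
  show "integrable M (\<lambda>\<omega>. indicator G (history n \<omega>) *
           exp (\<theta> * (S m \<omega> - S n \<omega>) - s * (T m \<omega> - T n \<omega>)))"
    using indep_var_integrable[OF indep intX intY] by (simp only: Y_eq)
  show "(\<integral>\<omega>. indicator G (history n \<omega>) *
           exp (\<theta> * (S m \<omega> - S n \<omega>) - s * (T m \<omega> - T n \<omega>)) \<partial>M) =
         prob {\<omega>\<in>space M. history n \<omega> \<in> G} * mgf \<theta> s ^ (m - n)"
    using indep_var_lebesgue_integral[OF indep intX intY] unfolding EX EY by (simp only: Y_eq)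
qed

lemma chernoff_increment:
  assumes G: "G \<in> sets (\<Pi>\<^sub>M k\<in>block 0 n. borel)" and mn: "n \<le> m" and s: "0 \<le> s"
    and int: "integrable M (\<lambda>\<omega>. exp (\<theta> * \<sigma> 0 \<omega>))"
  shows "prob {\<omega>\<in>space M. history n \<omega> \<in> G \<and>
             x \<le> \<theta> * (S m \<omega> - S n \<omega>) - s * (T m \<omega> - T n \<omega>)}
         \<le> prob {\<omega>\<in>space M. history n \<omega> \<in> G} * exp (- x) * mgf \<theta> s ^ (m - n)"
proof -
  let ?I = "\<lambda>\<omega>. \<theta> * (S m \<omega> - S n \<omega>) - s * (T m \<omega> - T n \<omega>)"
  let ?u = "\<lambda>\<omega>. indicator G (history n \<omega>) * exp (?I \<omega>) :: real"
  have "prob {\<omega>\<in>space M. history n \<omega> \<in> G \<and> x \<le> ?I \<omega>} = prob {\<omega>\<in>space M. exp x \<le> ?u \<omega>}"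
  proof (rule arg_cong[where f=prob])
    have "\<not> exp x \<le> 0" by simp
    then show "{\<omega>\<in>space M. history n \<omega> \<in> G \<and> x \<le> ?I \<omega>} = {\<omega>\<in>space M. exp x \<le> ?u \<omega>}"
      by (auto split: split_indicator)
  qed
  also have "\<dots> \<le> expectation ?u / exp x"
    by (rule integral_Markov_inequality_measure[OF exp_increment(1)[OF assms], where A="{}"])
       simp_all
  also have "\<dots> = prob {\<omega>\<in>space M. history n \<omega> \<in> G} * exp (- x) * mgf \<theta> s ^ (m - n)"
    by (subst exp_increment(2)[OF assms]) (simp add: exp_minus divide_inverse)
  finally show ?thesis .
qed

lemma mgf_nonneg: "0 \<le> mgf \<theta> s"
  unfolding mgf_def by (rule mult_nonneg_nonneg; rule Bochner_Integration.integral_nonneg; simp)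

lemma history_event:
  assumes "G \<in> sets (\<Pi>\<^sub>M k\<in>block 0 n. borel)"
  shows "{\<omega>\<in>space M. history n \<omega> \<in> G} \<in> events"
proof -
  have "{\<omega>\<in>space M. history n \<omega> \<in> G} = history n -` G \<inter> space M" by auto
  then show ?thesis using measurable_sets[OF history_measurable assms] by simp
qed

text \<open>
  If \<open>mgf \<theta> s < 1\<close>, the bounds of \<open>chernoff_increment\<close> form a geometric series in \<open>m\<close>. A plain union
  bound therefore takes the place of a maximal inequality for supermartingales, at the cost of the
  factor \<open>1 / (1 - mgf \<theta> s)\<close>.
\<close>

lemma future_exceedance:
  assumes G: "G \<in> sets (\<Pi>\<^sub>M k\<in>block 0 n. borel)" and s: "0 \<le> s"
    and int: "integrable M (\<lambda>\<omega>. exp (\<theta> * \<sigma> 0 \<omega>))" and lt1: "mgf \<theta> s < 1"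
  shows "prob {\<omega>\<in>space M. history n \<omega> \<in> G \<and>
             (\<exists>m\<ge>n. x \<le> \<theta> * (S m \<omega> - S n \<omega>) - s * (T m \<omega> - T n \<omega>))}
         \<le> prob {\<omega>\<in>space M. history n \<omega> \<in> G} * (exp (- x) / (1 - mgf \<theta> s))"
proof -
  let ?g = "prob {\<omega>\<in>space M. history n \<omega> \<in> G} * exp (- x)"
  define A where "A j = {\<omega>\<in>space M. history n \<omega> \<in> G \<and>
      x \<le> \<theta> * (S (n + j) \<omega> - S n \<omega>) - s * (T (n + j) \<omega> - T n \<omega>)}" for j
  have A_events [measurable]: "A j \<in> events" for j
  proof -
    have "A j = {\<omega>\<in>space M. history n \<omega> \<in> G} \<inter>
        {\<omega>\<in>space M. x \<le> \<theta> * (S (n + j) \<omega> - S n \<omega>) - s * (T (n + j) \<omega> - T n \<omega>)}"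
      by (auto simp: A_def)
    then show ?thesis using history_event[OF G] by simp
  qed
  have A_le: "prob (A j) \<le> ?g * mgf \<theta> s ^ j" for j
    using chernoff_increment[OF G _ s int, of "n + j" x] by (simp add: A_def)
  have geo: "(\<lambda>j. ?g * mgf \<theta> s ^ j) sums (?g * (1 / (1 - mgf \<theta> s)))"
    using geometric_sums[of "mgf \<theta> s"] lt1 mgf_nonneg[of \<theta> s] by (intro sums_mult) simp
  have summ: "summable (\<lambda>j. prob (A j))"
    using A_le by (intro summable_comparison_test'[OF sums_summable[OF geo], of 0]) simp
  have "prob {\<omega>\<in>space M. history n \<omega> \<in> G \<and>
      (\<exists>m\<ge>n. x \<le> \<theta> * (S m \<omega> - S n \<omega>) - s * (T m \<omega> - T n \<omega>))} = prob (\<Union>j. A j)"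
    by (rule arg_cong[where f=prob]) (auto simp: A_def le_iff_add)
  also have "\<dots> \<le> (\<Sum>j. prob (A j))"
    using summ by (intro finite_measure_subadditive_countably) auto
  also have "\<dots> \<le> (\<Sum>j. ?g * mgf \<theta> s ^ j)"
    by (intro suminf_le A_le summ sums_summable[OF geo])
  also have "\<dots> = ?g * (1 / (1 - mgf \<theta> s))"
    using geo by (simp add: sums_iff)
  finally show ?thesis by simp
qed

lemma exceedance:
  assumes s: "0 \<le> s"
    and int: "integrable M (\<lambda>\<omega>. exp (\<theta> * \<sigma> 0 \<omega>))" and lt1: "mgf \<theta> s < 1"
  shows "prob {\<omega>\<in>space M. \<exists>m. x \<le> \<theta> * S m \<omega> - s * T m \<omega>} \<le> exp (- x) / (1 - mgf \<theta> s)"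
proof -
  have "history 0 \<omega> \<in> space (\<Pi>\<^sub>M k\<in>block 0 0. borel)" for \<omega>
    by (simp add: space_PiM)
  with future_exceedance[OF sets.top s int lt1, of 0 x] show ?thesis
    by (simp add: prob_space)
qed

definition first_exceeds :: "real \<Rightarrow> real \<Rightarrow> nat \<Rightarrow> 'a \<Rightarrow> bool" where
  "first_exceeds p u n \<omega> \<longleftrightarrow>
     u + p * T n \<omega> < S n \<omega> \<and> (\<forall>k<n. \<not> u + p * T k \<omega> < S k \<omega>)"

lemma exceeds_imp_first:
  assumes "u + p * T n \<omega> < S n \<omega>"
  shows "\<exists>n. first_exceeds p u n \<omega>"
  using exists_least_iff[of "\<lambda>n. u + p * T n \<omega> < S n \<omega>"] assms
  unfolding first_exceeds_def by blast

text \<open>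
  The first exceedance is a stopping time: whether it occurs at \<open>n\<close> is decided by the first \<open>n\<close>
  interarrival times and claims.
\<close>

lemma first_exceeds_history:
  "\<exists>G\<in>sets (\<Pi>\<^sub>M k\<in>block 0 n. borel).
     {\<omega>\<in>space M. first_exceeds p u n \<omega>} = {\<omega>\<in>space M. history n \<omega> \<in> G}"
proof -
  define E where "E k h \<longleftrightarrow> u + p * (\<Sum>i<k. h (Inl i)) < (\<Sum>i<k. h (Inr i))"
    for k and h :: "nat + nat \<Rightarrow> real"
  define G where "G = {h \<in> space (\<Pi>\<^sub>M k\<in>block 0 n. borel). E n h \<and> (\<forall>k<n. \<not> E k h)}"
  have meas: "Measurable.pred (\<Pi>\<^sub>M k\<in>block 0 n. borel) (E k)" if "k \<le> n" for k
  proof -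
    have sum_meas: "(\<lambda>h. \<Sum>i<k. h (f i)) \<in> borel_measurable (\<Pi>\<^sub>M k\<in>block 0 n. (borel::real measure))"
      if "\<And>i. i < k \<Longrightarrow> f i \<in> block 0 n" for f :: "nat \<Rightarrow> nat + nat"
      by (rule borel_measurable_sum, rule measurable_component_singleton) (use that in auto)
    have [measurable]: "(\<lambda>h. \<Sum>i<k. h (Inl i)) \<in> borel_measurable (\<Pi>\<^sub>M k\<in>block 0 n. (borel::real measure))"
      "(\<lambda>h. \<Sum>i<k. h (Inr i)) \<in> borel_measurable (\<Pi>\<^sub>M k\<in>block 0 n. (borel::real measure))"
      using \<open>k \<le> n\<close> by (auto intro!: sum_meas simp: block_def)
    show ?thesis unfolding E_def by measurable
  qed
  have none_before: "Measurable.pred (\<Pi>\<^sub>M k\<in>block 0 n. borel) (\<lambda>h. \<forall>k<n. \<not> E k h)"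
  proof (rule pred_intros_countable(1))
    fix k show "Measurable.pred (\<Pi>\<^sub>M k\<in>block 0 n. borel) (\<lambda>h. k < n \<longrightarrow> \<not> E k h)"
      using meas[of k] by (cases "k < n") simp_all
  qed
  have "G \<in> sets (\<Pi>\<^sub>M k\<in>block 0 n. borel)"
    using sets.Int[OF predE[OF meas[of n]] predE[OF none_before]]
    by (simp add: G_def Int_def conj_ac cong: conj_cong)
  moreover have "E k (history n \<omega>) \<longleftrightarrow> u + p * T k \<omega> < S k \<omega>" if "k \<le> n" for k \<omega>
  proof -
    have "i < k \<Longrightarrow> Inl i \<in> block 0 n" "i < k \<Longrightarrow> Inr i \<in> block 0 n" for i
      using that by (auto simp: block_def)
    then show ?thesis by (simp add: E_def arrival_time_def S_def)
  qed
  then have "{\<omega>\<in>space M. first_exceeds p u n \<omega>} = {\<omega>\<in>space M. history n \<omega> \<in> G}"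
    by (auto simp: first_exceeds_def G_def space_PiM)
  ultimately show ?thesis by blast
qed

text \<open>
  Strong Markov property at the first exceedance: the events that it occurs at \<open>n\<close> are disjoint, and
  \<open>future_exceedance\<close> bounds the further climb by the same factor after each of them.
\<close>

lemma exceedance_after_first:
  assumes s: "0 \<le> s"
    and int: "integrable M (\<lambda>\<omega>. exp (\<theta> * \<sigma> 0 \<omega>))" and lt1: "mgf \<theta> s < 1"
  shows "prob {\<omega>\<in>space M. \<exists>n. first_exceeds p u n \<omega> \<and>
             (\<exists>m\<ge>n. x \<le> \<theta> * (S m \<omega> - S n \<omega>) - s * (T m \<omega> - T n \<omega>))}
         \<le> prob {\<omega>\<in>space M. \<exists>n. u + p * T n \<omega> < S n \<omega>} * (exp (- x) / (1 - mgf \<theta> s))"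
proof -
  let ?c = "exp (- x) / (1 - mgf \<theta> s)"
  define F where "F n = {\<omega>\<in>space M. first_exceeds p u n \<omega>}" for n
  define A where "A n = {\<omega>\<in>space M. first_exceeds p u n \<omega> \<and>
             (\<exists>m\<ge>n. x \<le> \<theta> * (S m \<omega> - S n \<omega>) - s * (T m \<omega> - T n \<omega>))}" for n
  have F_events [measurable]: "F n \<in> events" for n
    unfolding F_def first_exceeds_def by measurable
  have A_events [measurable]: "A n \<in> events" for n
  proof -
    have "A n = F n \<inter> (\<Union>m\<in>{n..}. {\<omega>\<in>space M. x \<le> \<theta> * (S m \<omega> - S n \<omega>) - s * (T m \<omega> - T n \<omega>)})"
      by (auto simp: A_def F_def)
    then show ?thesis by simp
  qed
  have A_le: "prob (A n) \<le> prob (F n) * ?c" for n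
  proof -
    obtain G where G: "G \<in> sets (\<Pi>\<^sub>M k\<in>block 0 n. borel)"
      and eq: "{\<omega>\<in>space M. first_exceeds p u n \<omega>} = {\<omega>\<in>space M. history n \<omega> \<in> G}"
      using first_exceeds_history[of n p u] by (rule bexE)
    have "A n = {\<omega>\<in>space M. history n \<omega> \<in> G \<and>
             (\<exists>m\<ge>n. x \<le> \<theta> * (S m \<omega> - S n \<omega>) - s * (T m \<omega> - T n \<omega>))}"
      unfolding A_def using eq by blast
    with future_exceedance[OF G s int lt1, of x] show ?thesis
      unfolding F_def eq by simp
  qed
  have disj: "disjoint_family F"
    unfolding disjoint_family_on_def F_def first_exceeds_def by (auto, metis linorder_neqE_nat)
  have F_sums: "(\<lambda>n. prob (F n)) sums prob (\<Union>n. F n)"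
    using disj by (intro finite_measure_UNION) auto
  have bound: "(\<lambda>n. prob (F n) * ?c) sums (prob (\<Union>n. F n) * ?c)"
    by (rule sums_mult2[OF F_sums])
  have summ: "summable (\<lambda>n. prob (A n))"
    using A_le by (intro summable_comparison_test'[OF sums_summable[OF bound], of 0]) simp
  have "prob {\<omega>\<in>space M. \<exists>n. first_exceeds p u n \<omega> \<and>
             (\<exists>m\<ge>n. x \<le> \<theta> * (S m \<omega> - S n \<omega>) - s * (T m \<omega> - T n \<omega>))} = prob (\<Union>n. A n)"
    by (rule arg_cong[where f=prob]) (auto simp: A_def)
  also have "\<dots> \<le> (\<Sum>n. prob (A n))"
    using summ by (intro finite_measure_subadditive_countably) auto
  also have "\<dots> \<le> (\<Sum>n. prob (F n) * ?c)"
    by (intro suminf_le A_le summ sums_summable[OF bound])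
  also have "\<dots> = prob (\<Union>n. F n) * ?c"
    using bound by (simp add: sums_iff)
  also have "(\<Union>n. F n) = {\<omega>\<in>space M. \<exists>n. u + p * T n \<omega> < S n \<omega>}"
    using exceeds_imp_first by (fastforce simp: F_def first_exceeds_def)
  finally show ?thesis .
qed

lemma mgf_eq_joint:
  assumes s: "0 \<le> s" and int: "integrable M (\<lambda>\<omega>. exp (\<theta> * \<sigma> 0 \<omega>))"
  shows "integrable M (\<lambda>\<omega>. exp (\<theta> * \<sigma> 0 \<omega> - s * \<zeta> 0 \<omega>))"
    and "mgf \<theta> s = (\<integral>\<omega>. exp (\<theta> * \<sigma> 0 \<omega> - s * \<zeta> 0 \<omega>) \<partial>M)"
proof -
  have "history 0 \<omega> \<in> space (\<Pi>\<^sub>M k\<in>block 0 0. borel)" for \<omega>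
    by (simp add: space_PiM)
  then show "integrable M (\<lambda>\<omega>. exp (\<theta> * \<sigma> 0 \<omega> - s * \<zeta> 0 \<omega>))"
    "mgf \<theta> s = (\<integral>\<omega>. exp (\<theta> * \<sigma> 0 \<omega> - s * \<zeta> 0 \<omega>) \<partial>M)"
    using exp_increment[OF sets.top _ s int, of 0 1]
    by (simp_all add: prob_space S_def arrival_time_def)
qed

lemma not_AE_zero_interarrival: "\<not> (AE \<omega> in M. \<zeta> 0 \<omega> = 0)"
proof
  assume "AE \<omega> in M. \<zeta> 0 \<omega> = 0"
  then have "AE \<omega> in M. \<not> 0 < \<zeta> 0 \<omega>" by eventually_elim simp
  then have "prob {\<omega>\<in>space M. 0 < \<zeta> 0 \<omega>} = 0"
    by (subst prob_eq_0) auto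
  with interarrival_nontrivial show False by simp
qed

text \<open>
  The event that \<open>T\<close> stays constant after \<open>n\<close> is contained in \<open>T (n + j) - T n \<le> 0\<close> for every \<open>j\<close>, and
  the bound for the functional \<open>- T\<close>, that is for \<open>\<theta> = 0\<close> and \<open>s = 1\<close>, decays
  geometrically in \<open>j\<close>.
\<close>

lemma AE_later_arrival: "AE \<omega> in M. \<forall>n. \<exists>m. T n \<omega> < T m \<omega>"
proof -
  have int: "integrable M (\<lambda>\<omega>. exp (0 * \<sigma> 0 \<omega>))" by simp
  have lt1: "mgf 0 1 < 1"
  proof -
    have "mgf 0 1 \<le> 1"
      using integral_le_const[OF integrable_exp_interarrival[of 1 0], of 1] interarrival_nonneg
      by (auto simp: mgf_def prob_space intro!: AE_I2)
    moreover have "mgf 0 1 \<noteq> 1"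
    proof
      assume "mgf 0 1 = 1"
      then have "(\<integral>\<omega>. 1 - exp (- \<zeta> 0 \<omega>) \<partial>M) = 0"
        using integrable_exp_interarrival[of 1 0] by (simp add: mgf_def prob_space)
      then have "AE \<omega> in M. 1 - exp (- \<zeta> 0 \<omega>) = 0"
        using integrable_exp_interarrival[of 1 0] interarrival_nonneg
        by (subst (asm) integral_nonneg_eq_0_iff_AE) (auto intro!: AE_I2)
      then show False using not_AE_zero_interarrival by simp
    qed
    ultimately show ?thesis by simp
  qed
  have "AE \<omega> in M. \<exists>m. T n \<omega> < T m \<omega>" for n
  proof -
    let ?E = "{\<omega>\<in>space M. \<forall>m. \<not> T n \<omega> < T m \<omega>}"
    have "prob ?E \<le> mgf 0 1 ^ j" for j
    proof -
      have top: "history n \<omega> \<in> space (\<Pi>\<^sub>M k\<in>block 0 n. borel)" for \<omega>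
        by (simp add: space_PiM)
      have "prob ?E \<le> prob {\<omega>\<in>space M. history n \<omega> \<in> space (\<Pi>\<^sub>M k\<in>block 0 n. borel) \<and>
          0 \<le> 0 * (S (n + j) \<omega> - S n \<omega>) - 1 * (T (n + j) \<omega> - T n \<omega>)}"
        using top by (intro finite_measure_mono) (auto simp: not_less)
      also have "\<dots> \<le> mgf 0 1 ^ j"
        using chernoff_increment[OF sets.top _ _ int, of n "n + j" 1 0] top
        by (simp add: prob_space)
      finally show ?thesis .
    qed
    moreover have "(\<lambda>j. mgf 0 1 ^ j) \<longlonglongrightarrow> 0"
      using lt1 mgf_nonneg[of 0 1] by (intro LIMSEQ_power_zero) simp
    ultimately have "prob ?E \<le> 0"
      by (intro LIMSEQ_le_const) auto
    then have "prob ?E = 0" using measure_nonneg[of M ?E] by linarith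
    then have "AE \<omega> in M. \<not> (\<forall>m. \<not> T n \<omega> < T m \<omega>)"
      by (subst (asm) prob_eq_0) auto
    then show ?thesis by simp
  qed
  then show ?thesis by (simp add: AE_all_countable)
qed

end

section \<open>Strictness of the exponential moment conditions\<close>

lemma exp_midpoint_le: "exp ((x + y) / 2) \<le> exp x + exp y" for x y :: real
proof -
  have "exp ((x + y) / 2) \<le> exp (max x y)" by simp
  also have "\<dots> \<le> exp x + exp y" by (simp add: max_def less_imp_le)
  finally show ?thesis .
qed

lemma (in prob_space) integrable_exp_midpoint:
  fixes X Y :: "'a \<Rightarrow> real"
  assumes X: "integrable M (\<lambda>\<omega>. exp (X \<omega>))" and Y: "integrable M (\<lambda>\<omega>. exp (Y \<omega>))"
    and [measurable]: "X \<in> borel_measurable M" "Y \<in> borel_measurable M"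
  shows "integrable M (\<lambda>\<omega>. exp ((X \<omega> + Y \<omega>) / 2))"
proof (rule Bochner_Integration.integrable_bound)
  show "integrable M (\<lambda>\<omega>. exp (X \<omega>) + exp (Y \<omega>))" using X Y by simp
  show "AE \<omega> in M. norm (exp ((X \<omega> + Y \<omega>) / 2)) \<le> norm (exp (X \<omega>) + exp (Y \<omega>))"
    using exp_midpoint_le by (intro AE_I2) (simp add: add_pos_pos less_imp_le)
qed measurable

text \<open>
  Strict convexity: the defect of the arithmetic-geometric mean inequality is half the square of
  \<open>exp (X / 2) - exp (Y / 2)\<close>, whose mean vanishes only if \<open>X\<close> and \<open>Y\<close> agree almost surely.
\<close>

lemma (in prob_space) expectation_exp_midpoint_less_1:
  fixes X Y :: "'a \<Rightarrow> real"
  assumes X: "integrable M (\<lambda>\<omega>. exp (X \<omega>))" and Y: "integrable M (\<lambda>\<omega>. exp (Y \<omega>))"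
    and [measurable]: "X \<in> borel_measurable M" "Y \<in> borel_measurable M"
    and EX: "expectation (\<lambda>\<omega>. exp (X \<omega>)) = 1" and EY: "expectation (\<lambda>\<omega>. exp (Y \<omega>)) = 1"
    and ne: "\<not> (AE \<omega> in M. X \<omega> = Y \<omega>)"
  shows "expectation (\<lambda>\<omega>. exp ((X \<omega> + Y \<omega>) / 2)) < 1"
proof -
  let ?Z = "\<lambda>\<omega>. exp ((X \<omega> + Y \<omega>) / 2)"
  have Z: "integrable M ?Z" by (rule integrable_exp_midpoint) fact+
  have sq: "exp (X \<omega>) + exp (Y \<omega>) - 2 * ?Z \<omega> = (exp (X \<omega> / 2) - exp (Y \<omega> / 2))\<^sup>2" for \<omega>
    by (simp add: power2_eq_square algebra_simps mult_exp_exp add_divide_distrib)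
  have eq: "expectation (\<lambda>\<omega>. (exp (X \<omega> / 2) - exp (Y \<omega> / 2))\<^sup>2) = 2 - 2 * expectation ?Z"
    using X Y Z by (simp add: sq[symmetric] EX EY)
  have int: "integrable M (\<lambda>\<omega>. (exp (X \<omega> / 2) - exp (Y \<omega> / 2))\<^sup>2)"
    using X Y Z by (simp add: sq[symmetric])
  have "expectation (\<lambda>\<omega>. (exp (X \<omega> / 2) - exp (Y \<omega> / 2))\<^sup>2) \<noteq> 0"
  proof
    assume "expectation (\<lambda>\<omega>. (exp (X \<omega> / 2) - exp (Y \<omega> / 2))\<^sup>2) = 0"
    then have "AE \<omega> in M. (exp (X \<omega> / 2) - exp (Y \<omega> / 2))\<^sup>2 = 0"
      using integral_nonneg_eq_0_iff_AE[OF int] by simp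
    then have "AE \<omega> in M. X \<omega> = Y \<omega>" by eventually_elim simp
    with ne show False by simp
  qed
  moreover have "0 \<le> expectation (\<lambda>\<omega>. (exp (X \<omega> / 2) - exp (Y \<omega> / 2))\<^sup>2)"
    by (rule Bochner_Integration.integral_nonneg) simp
  ultimately show ?thesis using eq by linarith
qed

context two_dim_compound_renewal_risk
begin

text \<open>
  If claims are proportional to interarrival times, the exponent \<open>\<gamma> (\<sigma> - p \<zeta>)\<close> is \<open>\<gamma> (c - p) \<zeta>\<close>, which
  has constant sign. Its exponential can have mean 1 only if it vanishes, and \<open>\<zeta>\<close> does not.
\<close>

lemma proportional_slope_eq:
  assumes \<gamma>: "0 < \<gamma>" and p: "0 < p"
    and int: "integrable M (\<lambda>\<omega>. exp (\<gamma> * \<sigma> 0 \<omega>))" and one: "mgf \<gamma> (\<gamma> * p) = 1"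
    and proportional: "AE \<omega> in M. \<sigma> 0 \<omega> = c * \<zeta> 0 \<omega>"
  shows "c = p"
proof (rule ccontr)
  assume "c \<noteq> p"
  let ?U = "\<lambda>\<omega>. exp (\<gamma> * \<sigma> 0 \<omega> - \<gamma> * p * \<zeta> 0 \<omega>)"
  have U: "integrable M ?U" "expectation ?U = 1"
    using mgf_eq_joint[of "\<gamma> * p" \<gamma>] \<gamma> p int one by auto
  have eq: "AE \<omega> in M. ?U \<omega> = exp (\<gamma> * (c - p) * \<zeta> 0 \<omega>)"
    using proportional by eventually_elim (simp add: algebra_simps)
  have int2: "integrable M (\<lambda>\<omega>. sgn (c - p) * (?U \<omega> - 1))"
    using U by simp
  have "AE \<omega> in M. 0 \<le> sgn (c - p) * (?U \<omega> - 1)"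
    using eq AE_space
  proof eventually_elim
    case (elim \<omega>)
    have z: "0 \<le> \<zeta> 0 \<omega>" using elim interarrival_nonneg by simp
    show ?case
    proof (cases "c < p")
      case True
      then have "\<gamma> * (c - p) * \<zeta> 0 \<omega> \<le> 0"
        using \<gamma> z by (intro mult_nonpos_nonneg mult_nonneg_nonpos) auto
      then show ?thesis using True elim by simp
    next
      case False
      then have "0 \<le> \<gamma> * (c - p) * \<zeta> 0 \<omega>" using \<gamma> z by simp
      then show ?thesis using False \<open>c \<noteq> p\<close> elim by simp
    qed
  qed
  moreover have "expectation (\<lambda>\<omega>. sgn (c - p) * (?U \<omega> - 1)) = 0"
    using U by (simp add: prob_space)
  ultimately have "AE \<omega> in M. sgn (c - p) * (?U \<omega> - 1) = 0"
    using integral_nonneg_eq_0_iff_AE[OF int2] by blast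
  with eq have "AE \<omega> in M. \<zeta> 0 \<omega> = 0"
  proof eventually_elim
    case (elim \<omega>)
    then show ?case using \<open>c \<noteq> p\<close> \<gamma> by (simp add: sgn_0_0)
  qed
  with not_AE_zero_interarrival show False by simp
qed

text \<open>
  Strictness could fail only if \<open>\<gamma>1 (\<sigma> - p1 \<zeta>)\<close> and \<open>\<gamma>2 (\<sigma> - p2 \<zeta>)\<close> agreed almost surely. Then either
  \<open>\<gamma>1 = \<gamma>2\<close> and \<open>\<zeta>\<close> vanishes, or claims are proportional to interarrival times with a factor that
  would have to equal both \<open>p1\<close> and \<open>p2\<close>.
\<close>

lemma mgf_midpoint_less_1:
  assumes \<gamma>: "0 < \<gamma>1" "0 < \<gamma>2"
    and int: "integrable M (\<lambda>\<omega>. exp (\<gamma>1 * \<sigma> 0 \<omega>))" "integrable M (\<lambda>\<omega>. exp (\<gamma>2 * \<sigma> 0 \<omega>))"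
    and one: "mgf \<gamma>1 (\<gamma>1 * p1) = 1" "mgf \<gamma>2 (\<gamma>2 * p2) = 1"
  shows "integrable M (\<lambda>\<omega>. exp ((\<gamma>1 + \<gamma>2) / 2 * \<sigma> 0 \<omega>))"
    and "mgf ((\<gamma>1 + \<gamma>2) / 2) ((\<gamma>1 * p1 + \<gamma>2 * p2) / 2) < 1"
proof -
  let ?U1 = "\<lambda>\<omega>. \<gamma>1 * \<sigma> 0 \<omega> - \<gamma>1 * p1 * \<zeta> 0 \<omega>"
  let ?U2 = "\<lambda>\<omega>. \<gamma>2 * \<sigma> 0 \<omega> - \<gamma>2 * p2 * \<zeta> 0 \<omega>"
  show int_mid: "integrable M (\<lambda>\<omega>. exp ((\<gamma>1 + \<gamma>2) / 2 * \<sigma> 0 \<omega>))"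
    using integrable_exp_midpoint[OF int] by (simp add: distrib_right)
  have ne: "\<not> (AE \<omega> in M. ?U1 \<omega> = ?U2 \<omega>)"
  proof
    assume eq: "AE \<omega> in M. ?U1 \<omega> = ?U2 \<omega>"
    show False
    proof (cases "\<gamma>1 = \<gamma>2")
      case True
      have "AE \<omega> in M. \<zeta> 0 \<omega> = 0"
        using eq by eventually_elim (use True \<gamma> premium_order in simp)
      with not_AE_zero_interarrival show False by simp
    next
      case False
      define c where "c = (\<gamma>1 * p1 - \<gamma>2 * p2) / (\<gamma>1 - \<gamma>2)"
      have proportional: "AE \<omega> in M. \<sigma> 0 \<omega> = c * \<zeta> 0 \<omega>"
        using eq
      proof eventually_elim
        case (elim \<omega>)
        then have "(\<gamma>1 - \<gamma>2) * \<sigma> 0 \<omega> = (\<gamma>1 * p1 - \<gamma>2 * p2) * \<zeta> 0 \<omega>"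
          by (simp add: algebra_simps)
        then show ?case using False by (simp add: c_def field_simps)
      qed
      have "c = p1" "c = p2"
        using proportional_slope_eq[OF _ _ _ _ proportional] \<gamma> premium_pos int one by blast+
      then show False using premium_order by simp
    qed
  qed
  have U1: "integrable M (\<lambda>\<omega>. exp (?U1 \<omega>))" "expectation (\<lambda>\<omega>. exp (?U1 \<omega>)) = 1"
    using mgf_eq_joint[of "\<gamma>1 * p1" \<gamma>1] \<gamma> premium_pos int one by auto
  have U2: "integrable M (\<lambda>\<omega>. exp (?U2 \<omega>))" "expectation (\<lambda>\<omega>. exp (?U2 \<omega>)) = 1"
    using mgf_eq_joint[of "\<gamma>2 * p2" \<gamma>2] \<gamma> premium_pos int one by auto
  have "expectation (\<lambda>\<omega>. exp ((?U1 \<omega> + ?U2 \<omega>) / 2)) < 1"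
    by (rule expectation_exp_midpoint_less_1[OF U1(1) U2(1) _ _ U1(2) U2(2) ne]) measurable
  also have "(\<lambda>\<omega>. exp ((?U1 \<omega> + ?U2 \<omega>) / 2)) =
      (\<lambda>\<omega>. exp ((\<gamma>1 + \<gamma>2) / 2 * \<sigma> 0 \<omega> - (\<gamma>1 * p1 + \<gamma>2 * p2) / 2 * \<zeta> 0 \<omega>))"
    by (simp add: algebra_simps add_divide_distrib diff_divide_distrib)
  also have "expectation \<dots> = mgf ((\<gamma>1 + \<gamma>2) / 2) ((\<gamma>1 * p1 + \<gamma>2 * p2) / 2)"
    using mgf_eq_joint(2)[OF _ int_mid, of "(\<gamma>1 * p1 + \<gamma>2 * p2) / 2"] \<gamma> premium_pos by simp
  finally show "mgf ((\<gamma>1 + \<gamma>2) / 2) ((\<gamma>1 * p1 + \<gamma>2 * p2) / 2) < 1" .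
qed

text \<open>
  Proportionality with factor \<open>p2\<close> would turn the net profit condition into an equality of means.
  The exponential moment makes the means finite, so that their quotient in \<open>ennreal\<close> is \<open>p2\<close>.
\<close>

lemma claims_not_AE_proportional:
  assumes \<gamma>: "0 < \<gamma>" and int: "integrable M (\<lambda>\<omega>. exp (\<gamma> * \<sigma> 0 \<omega>))"
  shows "\<not> (AE \<omega> in M. \<sigma> 0 \<omega> = p2 * \<zeta> 0 \<omega>)"
proof
  assume proportional: "AE \<omega> in M. \<sigma> 0 \<omega> = p2 * \<zeta> 0 \<omega>"
  let ?I = "\<integral>\<^sup>+\<omega>. ennreal (\<zeta> 0 \<omega>) \<partial>M"
  have "(\<integral>\<^sup>+\<omega>. ennreal (\<sigma> 0 \<omega>) \<partial>M) = (\<integral>\<^sup>+\<omega>. ennreal p2 * ennreal (\<zeta> 0 \<omega>) \<partial>M)"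
    using proportional premium_pos by (intro nn_integral_cong_AE) (auto simp: ennreal_mult')
  also have "\<dots> = ennreal p2 * ?I" by (rule nn_integral_cmult) measurable
  finally have claims: "(\<integral>\<^sup>+\<omega>. ennreal (\<sigma> 0 \<omega>) \<partial>M) = ennreal p2 * ?I" .
  have "integrable M (\<sigma> 0)"
  proof (rule Bochner_Integration.integrable_bound)
    show "integrable M (\<lambda>\<omega>. exp (\<gamma> * \<sigma> 0 \<omega>) / \<gamma>)" using int by simp
    show "AE \<omega> in M. norm (\<sigma> 0 \<omega>) \<le> norm (exp (\<gamma> * \<sigma> 0 \<omega>) / \<gamma>)"
    proof (rule AE_I2)
      fix \<omega> assume "\<omega> \<in> space M"
      then have "0 \<le> \<sigma> 0 \<omega>" by (rule claims_nonneg)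
      moreover have "\<gamma> * \<sigma> 0 \<omega> \<le> exp (\<gamma> * \<sigma> 0 \<omega>)"
        using exp_ge_add_one_self[of "\<gamma> * \<sigma> 0 \<omega>"] by linarith
      ultimately show "norm (\<sigma> 0 \<omega>) \<le> norm (exp (\<gamma> * \<sigma> 0 \<omega>) / \<gamma>)"
        using \<gamma> by (simp add: field_simps)
    qed
  qed measurable
  then have "(\<integral>\<^sup>+\<omega>. ennreal (\<sigma> 0 \<omega>) \<partial>M) < \<top>"
    using claims_nonneg by (subst nn_integral_eq_integral) (auto intro!: AE_I2)
  then have "?I \<noteq> \<top>"
    using premium_pos by (auto simp: claims ennreal_mult_top)
  moreover have "?I \<noteq> 0"
  proof
    assume "?I = 0"
    then have "AE \<omega> in M. ennreal (\<zeta> 0 \<omega>) = 0"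
      by (subst (asm) nn_integral_0_iff_AE) auto
    with AE_space have "AE \<omega> in M. \<zeta> 0 \<omega> = 0"
    proof eventually_elim
      case (elim \<omega>)
      then show ?case using interarrival_nonneg[of \<omega> 0] by (simp add: ennreal_eq_0_iff)
    qed
    with not_AE_zero_interarrival show False by simp
  qed
  ultimately have "ennreal p2 * ?I / ?I = ennreal p2" by (intro ennreal_mult_divide_eq)
  with net_profit2 show False by (simp add: claims)
qed

text \<open>
  The midpoint of \<open>(\<gamma>, \<gamma> p2)\<close> and the origin: a direction along the second barrier in which
  the exponential mean is strictly less than 1, so that \<open>future_exceedance\<close> controls climbs towards
  that barrier.
\<close>

lemma mgf_half_less_1:
  assumes \<gamma>: "0 < \<gamma>" and int: "integrable M (\<lambda>\<omega>. exp (\<gamma> * \<sigma> 0 \<omega>))"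
    and one: "mgf \<gamma> (\<gamma> * p2) = 1"
  shows "integrable M (\<lambda>\<omega>. exp (\<gamma> / 2 * \<sigma> 0 \<omega>))" and "mgf (\<gamma> / 2) (\<gamma> / 2 * p2) < 1"
proof -
  let ?U = "\<lambda>\<omega>. \<gamma> * \<sigma> 0 \<omega> - \<gamma> * p2 * \<zeta> 0 \<omega>"
  show int_half: "integrable M (\<lambda>\<omega>. exp (\<gamma> / 2 * \<sigma> 0 \<omega>))"
    using integrable_exp_midpoint[OF int, of "\<lambda>_. 0"] by simp
  have ne: "\<not> (AE \<omega> in M. ?U \<omega> = 0)"
  proof
    assume "AE \<omega> in M. ?U \<omega> = 0"
    then have "AE \<omega> in M. \<sigma> 0 \<omega> = p2 * \<zeta> 0 \<omega>"
      by eventually_elim (use \<gamma> in simp)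
    with claims_not_AE_proportional[OF \<gamma> int] show False by simp
  qed
  have U: "integrable M (\<lambda>\<omega>. exp (?U \<omega>))" "expectation (\<lambda>\<omega>. exp (?U \<omega>)) = 1"
    using mgf_eq_joint[of "\<gamma> * p2" \<gamma>] \<gamma> premium_pos int one by auto
  have "expectation (\<lambda>\<omega>. exp ((?U \<omega> + 0) / 2)) < 1"
    by (rule expectation_exp_midpoint_less_1[OF U(1) _ _ _ U(2) _ ne]) (simp_all add: prob_space)
  also have "(\<lambda>\<omega>. exp ((?U \<omega> + 0) / 2)) = (\<lambda>\<omega>. exp (\<gamma> / 2 * \<sigma> 0 \<omega> - \<gamma> / 2 * p2 * \<zeta> 0 \<omega>))"
    by (simp add: algebra_simps diff_divide_distrib)
  also have "expectation \<dots> = mgf (\<gamma> / 2) (\<gamma> / 2 * p2)"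
    using mgf_eq_joint(2)[OF _ int_half, of "\<gamma> / 2 * p2"] \<gamma> premium_pos by simp
  finally show "mgf (\<gamma> / 2) (\<gamma> / 2 * p2) < 1" .
qed

text \<open>
  Convexity of \<open>exp\<close> between \<open>- s \<zeta>\<close> and 0 bounds the value at \<open>((1 - r) s)\<close> by an affine function of
  \<open>r\<close>, which stays below 1 for small \<open>r\<close>.
\<close>

lemma mgf_less_1_perturb:
  assumes lt1: "mgf \<theta> s < 1" and s: "0 \<le> s0" "s0 < s"
  shows "\<exists>s'. s0 < s' \<and> s' < s \<and> mgf \<theta> s' < 1"
proof -
  let ?E = "expectation (\<lambda>\<omega>. exp (\<theta> * \<sigma> 0 \<omega>))"
  let ?Z = "\<lambda>s. expectation (\<lambda>\<omega>. exp (- (s * \<zeta> 0 \<omega>)))"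
  have E: "0 \<le> ?E" by (rule Bochner_Integration.integral_nonneg) simp
  have bound: "mgf \<theta> ((1 - r) * s) \<le> (1 - r) * mgf \<theta> s + r * ?E" if r: "0 < r" "r < 1" for r
  proof -
    have "?Z ((1 - r) * s) \<le> expectation (\<lambda>\<omega>. (1 - r) * exp (- (s * \<zeta> 0 \<omega>)) + r * 1)"
    proof (rule integral_mono)
      show "integrable M (\<lambda>\<omega>. exp (- ((1 - r) * s * \<zeta> 0 \<omega>)))"
        using r s by (intro integrable_exp_interarrival) simp
      show "integrable M (\<lambda>\<omega>. (1 - r) * exp (- (s * \<zeta> 0 \<omega>)) + r * 1)"
        using s integrable_exp_interarrival[of s 0] by simp
      fix \<omega>
      show "exp (- ((1 - r) * s * \<zeta> 0 \<omega>)) \<le> (1 - r) * exp (- (s * \<zeta> 0 \<omega>)) + r * 1"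
        using convex_onD[OF exp_convex, of r "- (s * \<zeta> 0 \<omega>)" 0] r
        by (simp add: algebra_simps)
    qed
    also have "\<dots> = (1 - r) * ?Z s + r"
      using s integrable_exp_interarrival[of s 0] by (simp add: prob_space)
    finally have "?E * ?Z ((1 - r) * s) \<le> ?E * ((1 - r) * ?Z s + r)"
      using E by (rule mult_left_mono)
    then show ?thesis by (simp add: mgf_def algebra_simps)
  qed
  have "((\<lambda>r. (1 - r) * mgf \<theta> s + r * ?E) \<longlongrightarrow> (1 - 0) * mgf \<theta> s + 0 * ?E) (at_right 0)"
    by (intro tendsto_intros)
  then have ev1: "\<forall>\<^sub>F r in at_right 0. (1 - r) * mgf \<theta> s + r * ?E < 1"
    using lt1 by (intro order_tendstoD(2)) auto
  have "((\<lambda>r. (1 - r) * s) \<longlongrightarrow> (1 - 0) * s) (at_right 0)"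
    by (intro tendsto_intros)
  then have ev2: "\<forall>\<^sub>F r in at_right 0. s0 < (1 - r) * s"
    using s by (intro order_tendstoD(1)) auto
  have ev3: "\<forall>\<^sub>F r in at_right (0::real). r \<in> {0<..<1}"
    by (rule eventually_at_right_real) simp
  obtain r where r: "(1 - r) * mgf \<theta> s + r * ?E < 1" "s0 < (1 - r) * s" "0 < r" "r < 1"
    using eventually_happens'[OF _ eventually_conj[OF ev1 eventually_conj[OF ev2 ev3]]]
    by (auto simp: trivial_limit_at_right_real)
  have "(1 - r) * s < s" using r s by (simp add: algebra_simps)
  moreover have "mgf \<theta> ((1 - r) * s) < 1" using bound[OF r(3,4)] r(1) by linarith
  ultimately show ?thesis using r(2) by blast
qed

end

section \<open>Joint ruin\<close>

text \<open>
  The value \<open>\<theta> (1 + p2 t) - s t\<close>, multiplied by \<open>K\<close>, is that of the functional \<open>\<theta> S - s T\<close> at the point where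
  the two barriers cross. Below the third line \<open>\<theta> S - s T = c K\<close>, whose slope lies between \<open>p2\<close>
  and \<open>p1\<close> and which passes below the crossing point, the first barrier can be exceeded only before
  the crossing time and the second only after it. Between the second barrier and the third line there
  is, up to the crossing time, a gap of at least the stated size.
\<close>

lemma gap_when_both_lines_are_exceeded:
  fixes a c K p1 p2 s t \<theta> Sm Sn Tm Tn :: real
  assumes p: "p2 < p1" and t: "t = (1 - a) / (p1 - p2)" and K: "0 < K"
    and slope: "p2 * \<theta> \<le> s" "s \<le> p1 * \<theta>" and \<theta>: "0 < \<theta>"
    and c: "c < \<theta> * (1 + p2 * t) - s * t"
    and n: "a * K + p1 * Tn < Sn" "\<theta> * Sn - s * Tn < c * K"
    and m: "K + p2 * Tm < Sm" "\<theta> * Sm - s * Tm < c * K"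
  shows "Tn < Tm" "Sn - p2 * Tn < K - (\<theta> * (1 + p2 * t) - s * t - c) / \<theta> * K"
proof -
  define d where "d = \<theta> * (1 + p2 * t) - s * t - c"
  have d: "0 < d" using c by (simp add: d_def)
  have dK: "0 < d * K" using d K by simp
  have t_eq: "p1 * t = 1 - a + p2 * t"
  proof -
    have "(p1 - p2) * t = 1 - a" using p by (simp add: t)
    then show ?thesis by (simp add: algebra_simps)
  qed
  have n1: "\<theta> * (a * K + p1 * Tn) < \<theta> * Sn" using n(1) \<theta> by simp
  have m1: "\<theta> * (K + p2 * Tm) < \<theta> * Sm" using m(1) \<theta> by simp
  have pt: "\<theta> * (p1 * t) * K = \<theta> * (1 - a + p2 * t) * K" by (simp only: t_eq)
  \<comment> \<open>The first barrier minus the third line is a nondecreasing affine function of time, and it is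
    positive at the crossing time.\<close>
  have "(p1 * \<theta> - s) * (Tn - t * K) < - (d * K)"
  proof -
    have "(p1 * \<theta> - s) * (Tn - t * K) = \<theta> * (a * K + p1 * Tn) - s * Tn - c * K - d * K
        - (\<theta> * (p1 * t) * K - \<theta> * (1 - a + p2 * t) * K)"
      by (simp add: d_def algebra_simps)
    also have "\<dots> = \<theta> * (a * K + p1 * Tn) - s * Tn - c * K - d * K" by (simp only: pt)
    also have "\<dots> < - (d * K)" using n1 n(2) by linarith
    finally show ?thesis .
  qed
  then have Tn: "Tn < t * K"
    using dK slope(2) by (smt (verit) mult_nonneg_nonneg)
  have "d * K < (s - p2 * \<theta>) * (Tm - t * K)"
  proof -
    have "(s - p2 * \<theta>) * (Tm - t * K) = d * K + c * K - (\<theta> * (K + p2 * Tm) - s * Tm)"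
      by (simp add: d_def algebra_simps)
    then show ?thesis using m1 m(2) by linarith
  qed
  then have "t * K < Tm"
    using dK slope(1) by (smt (verit) mult_nonneg_nonpos)
  with Tn show "Tn < Tm" by simp
  have "\<theta> * (Sn - p2 * Tn) = (\<theta> * Sn - s * Tn) + (s - p2 * \<theta>) * Tn"
    by (simp add: algebra_simps)
  also have "\<dots> < c * K + (s - p2 * \<theta>) * (t * K)"
    using n(2) mult_left_mono[OF less_imp_le[OF Tn], of "s - p2 * \<theta>"] slope(1) by linarith
  also have "\<dots> = \<theta> * (K - d / \<theta> * K)"
    using \<theta> by (simp add: d_def field_simps)
  finally show "Sn - p2 * Tn < K - (\<theta> * (1 + p2 * t) - s * t - c) / \<theta> * K"
    using \<theta> by (simp add: d_def)
qed

context two_dim_compound_renewal_risk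
begin

definition ruin_event :: "real \<Rightarrow> real \<Rightarrow> 'a set" where
  "ruin_event p x = {\<omega>\<in>space M. \<exists>n. x + p * T n \<omega> < S n \<omega> \<and> (\<exists>m. T n \<omega> < T m \<omega>)}"

lemma ruin_event_measurable [measurable]: "ruin_event p x \<in> events"
  unfolding ruin_event_def by measurable

lemma ruin_time_finite_iff:
  "ruin_time \<zeta> \<sigma> p x \<omega> < \<infinity> \<longleftrightarrow> (\<exists>t\<ge>0. risk_process \<zeta> \<sigma> p x t \<omega> < 0)"
proof -
  have "ruin_time \<zeta> \<sigma> p x \<omega> < \<infinity> \<longleftrightarrow>
      (\<exists>y\<in>ereal ` {t. 0 \<le> t \<and> risk_process \<zeta> \<sigma> p x t \<omega> < 0}. y < \<infinity>)"
    unfolding ruin_time_def by (rule Inf_less_iff)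
  then show ?thesis by auto
qed

lemma mem_ruin_event_iff:
  assumes "0 < p" "0 \<le> x"
  shows "\<omega> \<in> ruin_event p x \<longleftrightarrow> \<omega> \<in> space M \<and> (\<exists>t\<ge>0. risk_process \<zeta> \<sigma> p x t \<omega> < 0)"
  using ruin_iff[OF _ assms] unfolding ruin_event_def by blast

lemma ruin_prob_eq:
  assumes "0 < p" "0 \<le> x"
  shows "ruin_prob M \<zeta> \<sigma> p x = prob (ruin_event p x)"
  unfolding ruin_prob_def ruin_time_finite_iff
  by (rule arg_cong[where f=prob]) (use mem_ruin_event_iff[OF assms] in blast)

lemma ruin_prob_and_eq:
  assumes "0 \<le> x1" "0 \<le> x2"
  shows "ruin_prob_and M \<zeta> \<sigma> p1 p2 x1 x2 = prob (ruin_event p1 x1 \<inter> ruin_event p2 x2)"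
  unfolding ruin_prob_and_def ruin_time_finite_iff
  by (rule arg_cong[where f=prob])
     (use mem_ruin_event_iff[OF premium_pos(1) assms(1)]
        mem_ruin_event_iff[OF premium_pos(2) assms(2)] in blast)

lemma ruin_prob_or_eq:
  assumes "0 \<le> x1" "0 \<le> x2"
  shows "ruin_prob_or M \<zeta> \<sigma> p1 p2 x1 x2 =
    ruin_prob M \<zeta> \<sigma> p1 x1 + ruin_prob M \<zeta> \<sigma> p2 x2 - ruin_prob_and M \<zeta> \<sigma> p1 p2 x1 x2"
proof -
  have "ruin_prob_or M \<zeta> \<sigma> p1 p2 x1 x2 = prob (ruin_event p1 x1 \<union> ruin_event p2 x2)"
    unfolding ruin_prob_or_def
    by (rule arg_cong[where f=prob])
       (use mem_ruin_event_iff[OF premium_pos(1) assms(1)]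
          mem_ruin_event_iff[OF premium_pos(2) assms(2)] in blast)
  then show ?thesis
    using assms premium_pos
    by (simp add: ruin_prob_eq ruin_prob_and_eq measure_Un3 fmeasurable_eq_sets)
qed

text \<open>
  Almost surely every arrival is followed by a strictly later one, so ruin agrees up to a null
  event with exceeding the barrier at some arrival. Only the latter has a first occurrence that is
  decided by the past.
\<close>

lemma ruin_prob_eq_exceedance:
  assumes "0 < p" "0 \<le> x"
  shows "ruin_prob M \<zeta> \<sigma> p x = prob {\<omega>\<in>space M. \<exists>n. x + p * T n \<omega> < S n \<omega>}"
  unfolding ruin_prob_eq[OF assms]
proof (rule measure_eq_AE)
  show "AE \<omega> in M. \<omega> \<in> ruin_event p x \<longleftrightarrow> \<omega> \<in> {\<omega>\<in>space M. \<exists>n. x + p * T n \<omega> < S n \<omega>}"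
    using AE_later_arrival by eventually_elim (auto simp: ruin_event_def)
qed measurable

text \<open>
  Either the path crosses the third line, which \<open>exceedance\<close> bounds by the first term, or it has to
  climb a further \<open>\<delta> K\<close> relative to the second barrier after its first exceedance of the first
  barrier. The functional \<open>(\<kappa>, \<kappa> p2)\<close> measures that climb.
\<close>

lemma joint_ruin_bound:
  assumes t: "t = (1 - a) / (p1 - p2)" and a: "0 < a" and K: "0 < K"
    and slope: "p2 * \<theta> \<le> s" "s \<le> p1 * \<theta>" and \<theta>: "0 < \<theta>"
    and int: "integrable M (\<lambda>\<omega>. exp (\<theta> * \<sigma> 0 \<omega>))" and lt1: "mgf \<theta> s < 1"
    and c: "c < \<theta> * (1 + p2 * t) - s * t"
    and \<kappa>: "0 < \<kappa>" and int': "integrable M (\<lambda>\<omega>. exp (\<kappa> * \<sigma> 0 \<omega>))" and lt1': "mgf \<kappa> (\<kappa> * p2) < 1"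
  defines "\<delta> \<equiv> (\<theta> * (1 + p2 * t) - s * t - c) / \<theta>"
  shows "ruin_prob_and M \<zeta> \<sigma> p1 p2 (a * K) K \<le>
    exp (- (c * K)) / (1 - mgf \<theta> s) +
    ruin_prob M \<zeta> \<sigma> p1 (a * K) * (exp (- (\<kappa> * \<delta> * K)) / (1 - mgf \<kappa> (\<kappa> * p2)))"
proof -
  define B where "B = {\<omega>\<in>space M. \<exists>m. c * K \<le> \<theta> * S m \<omega> - s * T m \<omega>}"
  define F where "F = {\<omega>\<in>space M. \<exists>n. first_exceeds p1 (a * K) n \<omega> \<and>
     (\<exists>m\<ge>n. \<kappa> * \<delta> * K \<le> \<kappa> * (S m \<omega> - S n \<omega>) - \<kappa> * p2 * (T m \<omega> - T n \<omega>))}"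
  have s: "0 \<le> s" using slope(1) \<theta> premium_pos by (smt (verit) mult_nonneg_nonneg)
  have B_events: "B \<in> events" unfolding B_def by measurable
  have F_events: "F \<in> events" unfolding F_def first_exceeds_def by measurable
  have sub: "ruin_event p1 (a * K) \<inter> ruin_event p2 K \<subseteq> B \<union> F"
  proof
    fix \<omega> assume w: "\<omega> \<in> ruin_event p1 (a * K) \<inter> ruin_event p2 K"
    then have sp: "\<omega> \<in> space M" by (auto simp: ruin_event_def)
    obtain n where n: "first_exceeds p1 (a * K) n \<omega>"
      using w exceeds_imp_first[of "a * K" p1 _ \<omega>] by (auto simp: ruin_event_def)
    obtain m where m: "K + p2 * T m \<omega> < S m \<omega>"
      using w by (auto simp: ruin_event_def)
    show "\<omega> \<in> B \<union> F"
    proof (cases "\<omega> \<in> B")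
      case False
      then have below: "\<theta> * S k \<omega> - s * T k \<omega> < c * K" for k
        using sp by (auto simp: B_def not_le)
      have n': "a * K + p1 * T n \<omega> < S n \<omega>" using n by (simp add: first_exceeds_def)
      note gap = gap_when_both_lines_are_exceeded[OF premium_order t K slope \<theta> c n' below m below]
      have "n \<le> m"
        using T_mono[OF sp, of m n] gap(1) by (cases "n \<le> m") auto
      moreover have "\<delta> * K \<le> (S m \<omega> - S n \<omega>) - p2 * (T m \<omega> - T n \<omega>)"
        using gap(2) m by (simp add: \<delta>_def algebra_simps)
      then have "\<kappa> * (\<delta> * K) \<le> \<kappa> * ((S m \<omega> - S n \<omega>) - p2 * (T m \<omega> - T n \<omega>))"
        using \<kappa> by (intro mult_left_mono) auto
      then have "\<kappa> * \<delta> * K \<le> \<kappa> * (S m \<omega> - S n \<omega>) - \<kappa> * p2 * (T m \<omega> - T n \<omega>)"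
        by (simp add: algebra_simps)
      ultimately show ?thesis using n sp unfolding F_def by blast
    qed simp
  qed
  have "ruin_prob_and M \<zeta> \<sigma> p1 p2 (a * K) K = prob (ruin_event p1 (a * K) \<inter> ruin_event p2 K)"
    using a K by (simp add: ruin_prob_and_eq)
  also have "\<dots> \<le> prob (B \<union> F)"
    using sub B_events F_events by (intro finite_measure_mono) auto
  also have "\<dots> \<le> prob B + prob F"
    using B_events F_events by (rule measure_Un_le)
  also have "prob B \<le> exp (- (c * K)) / (1 - mgf \<theta> s)"
    unfolding B_def by (rule exceedance[OF s int lt1])
  also have "prob F \<le> ruin_prob M \<zeta> \<sigma> p1 (a * K) * (exp (- (\<kappa> * \<delta> * K)) / (1 - mgf \<kappa> (\<kappa> * p2)))"
  proof -
    have "0 \<le> \<kappa> * p2" using \<kappa> premium_pos by simp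
    from exceedance_after_first[OF this int' lt1', of p1 "a * K" "\<kappa> * \<delta> * K"]
    show ?thesis
      unfolding F_def using ruin_prob_eq_exceedance[of p1 "a * K"] premium_pos a K by simp
  qed
  finally show ?thesis by simp
qed

end

theorem theorem4:
  fixes M :: "'a measure"
    and \<zeta> \<sigma> :: "nat \<Rightarrow> 'a \<Rightarrow> real"
    and p1 p2 a \<gamma>1 \<gamma>2 \<epsilon> C1 C2 :: real
  assumes model: "two_dim_compound_renewal_risk M \<zeta> \<sigma> p1 p2"
    and a: "0 < a" "a < 1"
    and gamma_pos: "0 < \<gamma>1" "0 < \<gamma>2"
    and eps_pos: "0 < \<epsilon>"
    and cramer1: "(\<integral>\<omega>. exp (- \<gamma>1 * p1 * \<zeta> 0 \<omega>) \<partial>M) * (\<integral>\<omega>. exp (\<gamma>1 * \<sigma> 0 \<omega>) \<partial>M) = 1"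
    and cramer2: "(\<integral>\<omega>. exp (- \<gamma>2 * p2 * \<zeta> 0 \<omega>) \<partial>M) * (\<integral>\<omega>. exp (\<gamma>2 * \<sigma> 0 \<omega>) \<partial>M) = 1"
    and moment1: "integrable M (\<lambda>\<omega>. exp ((\<gamma>1 + \<epsilon>) * \<sigma> 0 \<omega>))"
    and moment2: "integrable M (\<lambda>\<omega>. exp ((\<gamma>2 + \<epsilon>) * \<sigma> 0 \<omega>))"
    and C1_pos: "0 < C1"
    and C1: "((\<lambda>x. exp (\<gamma>1 * x) * ruin_prob M \<zeta> \<sigma> p1 x) \<longlongrightarrow> C1) at_top"
    and C2_pos: "0 < C2"
    and C2: "((\<lambda>x. exp (\<gamma>2 * x) * ruin_prob M \<zeta> \<sigma> p2 x) \<longlongrightarrow> C2) at_top"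
  shows "(\<lambda>K. ruin_prob_or M \<zeta> \<sigma> p1 p2 (a * K) K)
           \<sim>[at_top] (\<lambda>K. C2 * exp (- \<gamma>2 * K) + C1 * exp (- \<gamma>1 * a * K))
       \<and> (\<lambda>K. ruin_prob_and M \<zeta> \<sigma> p1 p2 (a * K) K)
           \<in> o[at_top](\<lambda>K. C2 * exp (- \<gamma>2 * K) + C1 * exp (- \<gamma>1 * a * K))"
proof -
  interpret two_dim_compound_renewal_risk M \<zeta> \<sigma> p1 p2 by (rule model)
  have int1: "integrable M (\<lambda>\<omega>. exp (\<gamma>1 * \<sigma> 0 \<omega>))"
    using cramer1 not_integrable_integral_eq by fastforce
  have int2: "integrable M (\<lambda>\<omega>. exp (\<gamma>2 * \<sigma> 0 \<omega>))"
    using cramer2 not_integrable_integral_eq by fastforce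
  have one: "mgf \<gamma>1 (\<gamma>1 * p1) = 1" "mgf \<gamma>2 (\<gamma>2 * p2) = 1"
    using cramer1 cramer2 by (simp_all add: mgf_def mult.commute)
  \<comment> \<open>Lowering \<open>s\<close> from the midpoint value \<open>s0\<close> raises the functional at the crossing point by \<open>(s0 - s) t\<close>;
    half of this gain, \<open>\<rho>\<close>, is put into the level \<open>c\<close> and the other half into the gap.\<close>
  define \<theta> where "\<theta> = (\<gamma>1 + \<gamma>2) / 2"
  define s0 where "s0 = (\<gamma>1 * p1 + \<gamma>2 * p2) / 2"
  define t where "t = (1 - a) / (p1 - p2)"
  have t_pos: "0 < t" using a premium_order by (simp add: t_def)
  have \<theta>: "0 < \<theta>" using gamma_pos by (simp add: \<theta>_def)
  have int: "integrable M (\<lambda>\<omega>. exp (\<theta> * \<sigma> 0 \<omega>))" and "mgf \<theta> s0 < 1"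
    unfolding \<theta>_def s0_def by (rule mgf_midpoint_less_1[OF gamma_pos int1 int2 one])+
  moreover have "p2 * \<theta> < s0"
  proof -
    have "s0 - p2 * \<theta> = \<gamma>1 * (p1 - p2) / 2" by (simp add: s0_def \<theta>_def field_simps)
    moreover have "0 < \<gamma>1 * (p1 - p2) / 2" using gamma_pos premium_order by simp
    ultimately show ?thesis by linarith
  qed
  moreover have "0 \<le> p2 * \<theta>" using premium_pos \<theta> by simp
  ultimately obtain s where s: "p2 * \<theta> < s" "s < s0" and lt1: "mgf \<theta> s < 1"
    using mgf_less_1_perturb[of \<theta> s0 "p2 * \<theta>"] by blast
  have s_le: "s \<le> p1 * \<theta>"
  proof -
    have "p1 * \<theta> - s0 = \<gamma>2 * (p1 - p2) / 2" by (simp add: s0_def \<theta>_def field_simps)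
    moreover have "0 < \<gamma>2 * (p1 - p2) / 2" using gamma_pos premium_order by simp
    ultimately show ?thesis using s(2) by linarith
  qed
  define \<rho> where "\<rho> = (s0 - s) * t / 2"
  have \<rho>: "0 < \<rho>" using s t_pos by (simp add: \<rho>_def)
  define c where "c = (\<gamma>1 * a + \<gamma>2) / 2 + \<rho>"
  have corner: "\<theta> * (1 + p2 * t) - s * t = c + \<rho>"
  proof -
    have "(p1 - p2) * t = 1 - a" using premium_order by (simp add: t_def)
    then have "\<gamma>1 * ((p1 - p2) * t) = \<gamma>1 * (1 - a)" by simp
    then show ?thesis by (simp add: c_def \<rho>_def \<theta>_def s0_def field_simps)
  qed
  define \<kappa> where "\<kappa> = \<gamma>2 / 2"
  have \<kappa>: "0 < \<kappa>" using gamma_pos by (simp add: \<kappa>_def)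
  have int': "integrable M (\<lambda>\<omega>. exp (\<kappa> * \<sigma> 0 \<omega>))" and lt1': "mgf \<kappa> (\<kappa> * p2) < 1"
    unfolding \<kappa>_def by (rule mgf_half_less_1[OF gamma_pos(2) int2 one(2)])+
  define b where "b = \<kappa> * (\<rho> / \<theta>)"
  have b: "0 < b" using \<kappa> \<rho> \<theta> by (simp add: b_def)
  define A where "A = 1 / (1 - mgf \<theta> s)"
  define A' where "A' = 1 / (1 - mgf \<kappa> (\<kappa> * p2))"
  have A: "0 \<le> A" "0 \<le> A'" using lt1 lt1' by (simp_all add: A_def A'_def)
  let ?and = "\<lambda>K. ruin_prob_and M \<zeta> \<sigma> p1 p2 (a * K) K"
  let ?or = "\<lambda>K. ruin_prob_or M \<zeta> \<sigma> p1 p2 (a * K) K"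
  let ?r1 = "\<lambda>K. ruin_prob M \<zeta> \<sigma> p1 (a * K)"
  let ?r2 = "\<lambda>K. ruin_prob M \<zeta> \<sigma> p2 K"
  define e1 where "e1 K = exp (- \<gamma>1 * a * K)" for K :: real
  define e2 where "e2 K = exp (- \<gamma>2 * K)" for K :: real
  define D where "D K = C2 * e2 K + C1 * e1 K" for K
  have e_pos: "0 < e1 K" "0 < e2 K" for K by (simp_all add: e1_def e2_def)
  have D_pos: "0 < D K" for K using e_pos C1_pos C2_pos by (simp add: D_def add_pos_pos)
  have e1_O: "e1 \<in> O[at_top](D)"
  proof (rule bigoI[of _ "1 / C1"], rule always_eventually, rule allI)
    fix K show "norm (e1 K) \<le> 1 / C1 * norm (D K)"
      using e_pos[of K] C1_pos C2_pos D_pos[of K] by (simp add: D_def field_simps)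
  qed
  have e2_O: "e2 \<in> O[at_top](D)"
  proof (rule bigoI[of _ "1 / C2"], rule always_eventually, rule allI)
    fix K show "norm (e2 K) \<le> 1 / C2 * norm (D K)"
      using e_pos[of K] C1_pos C2_pos D_pos[of K] by (simp add: D_def field_simps)
  qed
  have rescale: "(r - C * exp (- x)) / exp (- x) = exp x * r - C" for r C x :: real
    by (simp add: exp_minus divide_inverse left_diff_distrib)
  have r1_o: "(\<lambda>K. ?r1 K - C1 * e1 K) \<in> o[at_top](e1)"
  proof (rule smalloI_tendsto)
    have "filterlim (\<lambda>K. a * K) at_top at_top"
      using a(1) by (intro filterlim_tendsto_pos_mult_at_top[OF tendsto_const] filterlim_ident) auto
    then have "((\<lambda>K. exp (\<gamma>1 * (a * K)) * ?r1 K - C1) \<longlongrightarrow> C1 - C1) at_top"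
      by (intro tendsto_diff tendsto_const filterlim_compose[OF C1])
    moreover have "(?r1 K - C1 * e1 K) / e1 K = exp (\<gamma>1 * (a * K)) * ?r1 K - C1" for K
      using rescale[of "?r1 K" C1 "\<gamma>1 * (a * K)"] by (simp add: e1_def mult.assoc)
    ultimately show "((\<lambda>K. (?r1 K - C1 * e1 K) / e1 K) \<longlongrightarrow> 0) at_top" by simp
  qed (use e_pos in \<open>simp add: less_imp_neq[symmetric]\<close>)
  have r2_o: "(\<lambda>K. ?r2 K - C2 * e2 K) \<in> o[at_top](e2)"
  proof (rule smalloI_tendsto)
    have "((\<lambda>K. exp (\<gamma>2 * K) * ?r2 K - C2) \<longlongrightarrow> C2 - C2) at_top"
      by (intro tendsto_diff tendsto_const C2)
    moreover have "(?r2 K - C2 * e2 K) / e2 K = exp (\<gamma>2 * K) * ?r2 K - C2" for K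
      using rescale[of "?r2 K" C2 "\<gamma>2 * K"] by (simp add: e2_def)
    ultimately show "((\<lambda>K. (?r2 K - C2 * e2 K) / e2 K) \<longlongrightarrow> 0) at_top" by simp
  qed (use e_pos in \<open>simp add: less_imp_neq[symmetric]\<close>)
  have r1_O: "?r1 \<in> O[at_top](e1)"
  proof -
    have "(\<lambda>K. (?r1 K - C1 * e1 K) + C1 * e1 K) \<in> O[at_top](e1)"
      by (intro sum_in_bigo landau_o.small_imp_big[OF r1_o]) simp
    then show ?thesis by simp
  qed
  have decay: "(\<lambda>K. exp (- (q * K))) \<in> o[at_top](\<lambda>_. 1)" if "0 < q" for q :: real
  proof (rule smalloI_tendsto)
    have "filterlim (\<lambda>K. q * K) at_top at_top"
      using that by (intro filterlim_tendsto_pos_mult_at_top[OF tendsto_const] filterlim_ident) auto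
    then have "((\<lambda>K. exp (- (q * K))) \<longlongrightarrow> 0) at_top"
      by (intro filterlim_compose[OF exp_at_bot]) (simp add: filterlim_uminus_at_top[symmetric])
    then show "((\<lambda>K. exp (- (q * K)) / 1) \<longlongrightarrow> 0) at_top" by simp
  qed simp
  \<comment> \<open>Apart from \<open>\<rho>\<close>, the exponent \<open>c\<close> is the average of the two decay exponents, so its exponential is
    dominated by the larger of \<open>e1\<close> and \<open>e2\<close> .\<close>
  have cK: "exp (- (c * K)) \<le> exp (- (\<rho> * K)) * (e1 K + e2 K)" for K
  proof -
    have "exp (- (c * K)) = exp (- (\<rho> * K)) * exp ((- \<gamma>1 * a * K + - \<gamma>2 * K) / 2)"
      by (simp add: c_def exp_add[symmetric] field_simps)
    moreover have "exp ((- \<gamma>1 * a * K + - \<gamma>2 * K) / 2) \<le> e1 K + e2 K"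
      unfolding e1_def e2_def by (rule exp_midpoint_le)
    ultimately show ?thesis by simp
  qed
  let ?bound = "\<lambda>K. A * (exp (- (\<rho> * K)) * (e1 K + e2 K)) + A' * (exp (- (b * K)) * ?r1 K)"
  have bound: "?and K \<le> ?bound K" if "0 < K" for K
  proof -
    have "c < \<theta> * (1 + p2 * t) - s * t" using corner \<rho> by simp
    from joint_ruin_bound[OF t_def a(1) that less_imp_le[OF s(1)] s_le \<theta> int lt1 this \<kappa> int' lt1']
    have "?and K \<le> A * exp (- (c * K)) + A' * (exp (- (b * K)) * ?r1 K)"
      by (simp add: corner A_def A'_def b_def mult_ac)
    also have "\<dots> \<le> ?bound K"
      using mult_left_mono[OF cK A(1)] by simp
    finally show ?thesis .
  qed
  have "?and \<in> O[at_top](?bound)"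
  proof (rule bigoI[of _ 1])
    show "\<forall>\<^sub>F K in at_top. norm (?and K) \<le> 1 * norm (?bound K)"
      using eventually_gt_at_top[of 0]
    proof eventually_elim
      case (elim K)
      have "0 \<le> ?and K" by (simp add: ruin_prob_and_def)
      then show ?case using bound[OF elim] by simp
    qed
  qed
  also have "?bound \<in> o[at_top](D)"
  proof (rule sum_in_smallo)
    have "(\<lambda>K. exp (- (\<rho> * K)) * (e1 K + e2 K)) \<in> o[at_top](\<lambda>K. 1 * D K)"
      by (intro landau_o.small_big_mult decay \<rho> sum_in_bigo e1_O e2_O)
    then show "(\<lambda>K. A * (exp (- (\<rho> * K)) * (e1 K + e2 K))) \<in> o[at_top](D)"
      by (simp add: landau_o.small.cmult_in_iff')
    have "(\<lambda>K. exp (- (b * K)) * ?r1 K) \<in> o[at_top](\<lambda>K. 1 * D K)"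
      by (intro landau_o.small_big_mult decay b landau_o.big_trans[OF r1_O e1_O])
    then show "(\<lambda>K. A' * (exp (- (b * K)) * ?r1 K)) \<in> o[at_top](D)"
      by simp
  qed
  finally have and_o: "?and \<in> o[at_top](D)" .
  have "(\<lambda>K. (?r2 K - C2 * e2 K) + (?r1 K - C1 * e1 K) - ?and K) \<in> o[at_top](D)"
    by (intro sum_in_smallo and_o landau_o.small_big_trans[OF r1_o e1_O]
        landau_o.small_big_trans[OF r2_o e2_O])
  also have "?this \<longleftrightarrow> (\<lambda>K. ?or K - D K) \<in> o[at_top](D)"
  proof (rule landau_o.small.in_cong)
    show "\<forall>\<^sub>F K in at_top. (?r2 K - C2 * e2 K) + (?r1 K - C1 * e1 K) - ?and K = ?or K - D K"
      using eventually_gt_at_top[of 0]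
      by eventually_elim (use a in \<open>simp add: ruin_prob_or_eq D_def\<close>)
  qed
  finally have "?or \<sim>[at_top] D" by (rule smallo_imp_asymp_equiv)
  with and_o show ?thesis unfolding D_def e1_def e2_def by simp
qed

end
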